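(* In the fixed setting described in the context, there exists a Borel set $S_\infty\subseteq X_\infty$, consisting of nonvertex points, such that $\mu_\infty(S_\infty)>0$ and for every $x\in S_\infty$ there exists a nonprincipal ultrafilter $\mathcal U(x)$ on $\mathbb N$ (depending on $x$) such that the tangent cone $T_x^{r_i(x),\mathcal U(x)}X_\infty$ does not embed, even topologically, into $\mathbb R$.
   Context: Thick families. A $p$-$q$ geodesic is an isometric embedding of a compact interval sending the left endpoint to $p$ and the right endpoint to $q$. A nonempty family $\Gamma$ of $p$-$q$ geodesics with common domain $[a,b]$ is concatenation closed if whenever $\gamma_1,\gamma_2\in\Gamma$, $c\in[a,b]$, $\gamma_1(c)=\gamma_2(c)$, the curve equal to $\gamma_1$ on $[a,c]$ and $\gamma_2$ on $[c,b]$ is in $\Gamma$. It is a thick family of geodesics if moreover there is $\alpha'>0$ such that for every $\gamma\in\Gamma$ and $a=t_0<\dots<t_k=b$ there exist $a=q_0<s_1<q_1<\dots<s_j<q_j=b$ and $\tilde\gamma\in\Gamma$ with $\{t_i\}\subseteq\{q_i\}$, $\gamma(q_i)=\tilde\gamma(q_i)$ for all $i$, and $\sum_{i=1}^jd(\gamma(s_i),\tilde\gamma(s_i))\ge\alpha'$. Graphs. A finite metric graph is a metric space $X$ with a finite vertex set $V(X)\subseteq X$ and a finite set $E(X)$ of subsets (edges) covering $X$, each edge isometric to a compact interval whose endpoints (and no interior points) correspond to vertices, two distinct edges being disjoint or meeting in one or two vertices. It is directed if each edge has a chosen order (source, sink) of its two vertices. $|A|$ denotes length measure of $A$. Thick inverse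 system. A sequence $X_0\subseteq X_1\subseteq\cdots$ of finite directed metric graphs, all carrying restrictions of one metric $d$, with maps $\pi_i^{i+1}:X_{i+1}\to X_i$, such that for all $i\ge0$: (A1) $X_0$ has two vertices $0,1$ and one edge, of length $1$, directed from $0$ to $1$. (A2) There is a directed subdivision $X_i'$ of $X_i$ such that for each $e'\in E(X_i')$, $(\pi_i^{i+1})^{-1}(e')=e'\cup e'_{\rm op}$, where $e'$ and $e'_{\rm op}$ are edges of $X_{i+1}$ and either $e'_{\rm op}=e'$ (the preimage is then called an interval) or $e'_{\rm op}$ has the same source and sink as $e'$ and its interior is disjoint from the rest of $X_{i+1}$ (the preimage is then called a circle). A subedge $e'\in E(X_i')$ of $e\in E(X_i)$ sharing a vertex with $e$ is called terminal, and the preimage of a terminal subedge is an interval. (A3) Every directed edge path of $X_i$ is isometric (for $d$) to a compact interval. (A4) $\pi_i^{i+1}$ is the identity on each $e'\in E(X_i')$ and maps $e'_{\rm op}$ isometrically onto $e'$. For $p\in e'$, $p^{\rm op}$ is the unique point of $e'_{\rm op}$ with $\pi_i^{i+1}(p^{\rm op})=p$. (A5) There is $\alpha>0$ independent of $i$ with $\max_{p\in e'}d(p,p^{\rm op})\ge\alpha|e'|$ for every $e'\in E(X_i')$ whose preimage is a circle. (A6) There is $\beta>0$ independent of $i$ such that for every directed edge path $P$ from $0$ to $1$ in $X_i'$, the edges $e'\subseteq P$ whose preimage is a circle have total length at least $\beta$. The system carries probability measures $\mu_i$: $\mu_0$ is length measure; $\mu_{i+1}$ is a constant multiple of length measure on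 each edge, with $\mu_{i+1}(e')=\mu_i(e')$ if $e'_{\rm op}=e'$ and $\mu_{i+1}(e')=\mu_{i+1}(e'_{\rm op})=\frac12\mu_i(e')$ otherwise. Parameters. $\Delta_i^E=\min_{e\in E(X_i)}|e|$, $\delta_i^E=\max_{e'\in E(X_i')}|e'|/\Delta_i^E$. $\Delta_i^d$ is the minimum of $d(e',X_i\setminus e)$ over $e\in E(X_i)$ and nonterminal subedges $e'\in E(X_i')$ of $e$ (distance to $\emptyset$ being $+\infty$), and $\delta_i^d=\max|e'|/\Delta_i^d$ over nonterminal $e'\in E(X_i')$. Fixed setting. $(M,d)$ is a complete metric space containing a thick family of geodesics; $(\delta_i')$ is a positive sequence decreasing to $0$ with $\delta_0'<\frac12$ and $\prod_{i=0}^\infty\frac1{1-2\delta_i'}\le L<\infty$; and a thick inverse system contained in $M$ (all $X_i\subseteq M$, with the metric $d$) with $\delta_i^E,\delta_i^d\le\delta_i'$ for all $i$ is fixed. $\pi_i^j:X_j\to X_i$ are the compositions; they are $L$-Lipschitz. $X_\infty$ is the closure of $\bigcup_iX_i$ in $M$ (a compact set), $\pi_i^\infty:X_\infty\to X_i$ are the continuous ($L$-Lipschitz) extensions of the $\pi_i^j$, and $\mu_\infty$ is the unique Borel probability measure on $X_\infty$ with $(\pi_i^\infty)_\#\mu_\infty=\mu_i$ for all $i$. Scales and tangent cones. $x\in X_\infty$ is a nonvertex if $\pi_i^\infty(x)\notin V(X_i)$ for all $i$; then $e_i(x)$ is the unique edge of $X_i$ containing $\pi_i^\infty(x)$ and $r_i(x)=|e_i(x)|$.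 $T_x^{r_i,\mathcal U}X_\infty$ is the $\mathcal U$-ultralimit of the pointed spaces $(X_\infty,\frac1{r_i}d,x)$. *)

theory Defs
  imports "HOL-Probability.Probability"
begin

definition geodesic :: "real \<Rightarrow> real \<Rightarrow> 'a::metric_space \<Rightarrow> 'a \<Rightarrow> (real \<Rightarrow> 'a) \<Rightarrow> bool" where
  "geodesic a b p q \<gamma> \<longleftrightarrow> a \<le> b \<and> \<gamma> a = p \<and> \<gamma> b = q \<and>
     (\<forall>s\<in>{a..b}. \<forall>t\<in>{a..b}. dist (\<gamma> s) (\<gamma> t) = \<bar>s - t\<bar>)"

text \<open>Curves on \<open>[a,b]\<close> are represented by extensional functions, so that equality of members of
  a family is equality of curves.\<close>

definition concat_curve ::
    "real \<Rightarrow> real \<Rightarrow> real \<Rightarrow> (real \<Rightarrow> 'a) \<Rightarrow> (real \<Rightarrow> 'a) \<Rightarrow> real \<Rightarrow> 'a" where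
  "concat_curve a b c \<gamma>1 \<gamma>2 = (\<lambda>t\<in>{a..b}. if t \<le> c then \<gamma>1 t else \<gamma>2 t)"

definition concatenation_closed ::
    "real \<Rightarrow> real \<Rightarrow> 'a::metric_space \<Rightarrow> 'a \<Rightarrow> (real \<Rightarrow> 'a) set \<Rightarrow> bool" where
  "concatenation_closed a b p q \<Gamma> \<longleftrightarrow>
     \<Gamma> \<noteq> {} \<and> (\<forall>\<gamma>\<in>\<Gamma>. geodesic a b p q \<gamma> \<and> \<gamma> \<in> extensional {a..b}) \<and>
     (\<forall>\<gamma>1\<in>\<Gamma>. \<forall>\<gamma>2\<in>\<Gamma>. \<forall>c\<in>{a..b}. \<gamma>1 c = \<gamma>2 c \<longrightarrow> concat_curve a b c \<gamma>1 \<gamma>2 \<in> \<Gamma>)"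

definition thick_family ::
    "real \<Rightarrow> real \<Rightarrow> 'a::metric_space \<Rightarrow> 'a \<Rightarrow> (real \<Rightarrow> 'a) set \<Rightarrow> bool" where
  "thick_family a b p q \<Gamma> \<longleftrightarrow> concatenation_closed a b p q \<Gamma> \<and>
     (\<exists>\<alpha>'>0. \<forall>\<gamma>\<in>\<Gamma>. \<forall>(k::nat) (t::nat \<Rightarrow> real).
        t 0 = a \<and> t k = b \<and> (\<forall>i<k. t i < t (Suc i)) \<longrightarrow>
        (\<exists>(j::nat) (q::nat \<Rightarrow> real) (s::nat \<Rightarrow> real). \<exists>\<gamma>'\<in>\<Gamma>.
           q 0 = a \<and> q j = b \<and>
           (\<forall>i\<in>{1..j}. q (i - 1) < s i \<and> s i < q i) \<and>
           t ` {0..k} \<subseteq> q ` {0..j} \<and>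
           (\<forall>i\<in>{0..j}. \<gamma> (q i) = \<gamma>' (q i)) \<and>
           (\<Sum>i=1..j. dist (\<gamma> (s i)) (\<gamma>' (s i))) \<ge> \<alpha>'))"

text \<open>All graphs are subsets of one metric space and carry the restriction of its metric, which
  need not be a path metric. The underlying set of a graph is the union of its edges.\<close>

record 'a mgraph =
  verts :: "'a set"
  edges :: "'a set set"
  src :: "'a set \<Rightarrow> 'a"
  snk :: "'a set \<Rightarrow> 'a"

definition points :: "('a, 'z) mgraph_scheme \<Rightarrow> 'a set" where
  "points G = \<Union>(edges G)"

definition is_segment :: "'a::metric_space set \<Rightarrow> 'a \<Rightarrow> 'a \<Rightarrow> bool" where
  "is_segment A u v \<longleftrightarrow> (\<exists>l>0. \<exists>\<phi>. geodesic 0 l u v \<phi> \<and> \<phi> ` {0..l} = A)"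

text \<open>Since an edge contains exactly two vertices, the last condition says that distinct edges
  are disjoint or meet in one or two vertices.\<close>

definition directed_metric_graph :: "'a::metric_space mgraph \<Rightarrow> bool" where
  "directed_metric_graph G \<longleftrightarrow>
     finite (verts G) \<and> finite (edges G) \<and> verts G \<subseteq> points G \<and>
     (\<forall>e\<in>edges G. is_segment e (src G e) (snk G e) \<and> e \<inter> verts G = {src G e, snk G e}) \<and>
     (\<forall>e\<in>edges G. \<forall>f\<in>edges G. e \<noteq> f \<longrightarrow> e \<inter> f \<subseteq> verts G)"

text \<open>An edge is isometric to an interval, so its length is the distance of its end points.\<close>

definition edge_length :: "'a::metric_space mgraph \<Rightarrow> 'a set \<Rightarrow> real" where
  "edge_length G e = dist (src G e) (snk G e)"

text \<open>The isometry of an edge \<open>e\<close> onto an interval is \<open>p \<mapsto> dist (src G e) p\<close>; the length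
  measure is the sum over the edges of the Lebesgue measure transported by it.\<close>

definition graph_length :: "'a::metric_space mgraph \<Rightarrow> 'a set \<Rightarrow> ennreal" where
  "graph_length G A = (\<Sum>e\<in>edges G. emeasure lborel (dist (src G e) ` (A \<inter> e)))"

definition directed_path :: "'a mgraph \<Rightarrow> 'a set list \<Rightarrow> bool" where
  "directed_path G P \<longleftrightarrow> P \<noteq> [] \<and> set P \<subseteq> edges G \<and>
     (\<forall>k. Suc k < length P \<longrightarrow> snk G (P ! k) = src G (P ! Suc k))"

definition directed_path_from_to :: "'a mgraph \<Rightarrow> 'a \<Rightarrow> 'a \<Rightarrow> 'a set list \<Rightarrow> bool" where
  "directed_path_from_to G u v P \<longleftrightarrow>
     directed_path G P \<and> src G (hd P) = u \<and> snk G (last P) = v"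

definition subedge :: "'a mgraph \<Rightarrow> 'a mgraph \<Rightarrow> 'a set \<Rightarrow> 'a set \<Rightarrow> bool" where
  "subedge G' G e' e \<longleftrightarrow> e' \<in> edges G' \<and> e \<in> edges G \<and> e' \<subseteq> e"

text \<open>The last inequality says that \<open>e'\<close> is directed like the edge \<open>e\<close> containing it.\<close>

definition directed_subdivision :: "'a::metric_space mgraph \<Rightarrow> 'a mgraph \<Rightarrow> bool" where
  "directed_subdivision G' G \<longleftrightarrow>
     directed_metric_graph G' \<and> points G' = points G \<and> verts G \<subseteq> verts G' \<and>
     (\<forall>e'\<in>edges G'. \<exists>e. subedge G' G e' e \<and>
        dist (src G e) (src G' e') < dist (src G e) (snk G' e'))"

definition terminal :: "'a mgraph \<Rightarrow> 'a mgraph \<Rightarrow> 'a set \<Rightarrow> 'a set \<Rightarrow> bool" where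
  "terminal G' G e' e \<longleftrightarrow> subedge G' G e' e \<and>
     {src G' e', snk G' e'} \<inter> {src G e, snk G e} \<noteq> {}"

definition nonterminal_subedges :: "'a mgraph \<Rightarrow> 'a mgraph \<Rightarrow> 'a set \<Rightarrow> 'a set set" where
  "nonterminal_subedges G' G e = {e'. subedge G' G e' e \<and> \<not> terminal G' G e' e}"

text \<open>\<open>X' i\<close> is the subdivision of \<open>X i\<close>, \<open>\<pi> i\<close> maps \<open>X (Suc i)\<close> to \<open>X i\<close>, and \<open>opp i e'\<close> is the
  opposite edge of \<open>e'\<close>; the preimage of \<open>e'\<close> is a circle iff \<open>opp i e' \<noteq> e'\<close>.\<close>

definition opp_point ::
    "(nat \<Rightarrow> 'a \<Rightarrow> 'a) \<Rightarrow> (nat \<Rightarrow> 'a set \<Rightarrow> 'a set) \<Rightarrow> nat \<Rightarrow> 'a set \<Rightarrow> 'a \<Rightarrow> 'a" where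
  "opp_point \<pi> opp i e' p = (THE q. q \<in> opp i e' \<and> \<pi> i q = p)"

locale thick_inverse_system =
  fixes X X' :: "nat \<Rightarrow> 'a::metric_space mgraph"
    and \<pi> :: "nat \<Rightarrow> 'a \<Rightarrow> 'a"
    and opp :: "nat \<Rightarrow> 'a set \<Rightarrow> 'a set"
    and v0 v1 :: 'a
  assumes graph: "\<And>i. directed_metric_graph (X i)"
    and increasing: "\<And>i. points (X i) \<subseteq> points (X (Suc i))"
    and maps_to: "\<And>i. \<pi> i ` points (X (Suc i)) \<subseteq> points (X i)"
    and A1: "verts (X 0) = {v0, v1}" "v0 \<noteq> v1"
      "\<exists>e. edges (X 0) = {e} \<and> src (X 0) e = v0 \<and> snk (X 0) e = v1 \<and> edge_length (X 0) e = 1"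
    and A2_subdivision: "\<And>i. directed_subdivision (X' i) (X i)"
    and A2_preimage: "\<And>i e'. e' \<in> edges (X' i) \<Longrightarrow>
      {p \<in> points (X (Suc i)). \<pi> i p \<in> e'} = e' \<union> opp i e'"
    and A2_edges: "\<And>i e'. e' \<in> edges (X' i) \<Longrightarrow>
      e' \<in> edges (X (Suc i)) \<and> opp i e' \<in> edges (X (Suc i)) \<and>
      src (X (Suc i)) e' = src (X' i) e' \<and> snk (X (Suc i)) e' = snk (X' i) e'"
    and A2_circle: "\<And>i e'. e' \<in> edges (X' i) \<Longrightarrow>
      opp i e' = e' \<or>
      src (X (Suc i)) (opp i e') = src (X (Suc i)) e' \<and>
      snk (X (Suc i)) (opp i e') = snk (X (Suc i)) e' \<and>
      (opp i e' - {src (X (Suc i)) e', snk (X (Suc i)) e'}) \<inter>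
        \<Union>(edges (X (Suc i)) - {opp i e'}) = {}"
    and A2_terminal: "\<And>i e' e. terminal (X' i) (X i) e' e \<Longrightarrow> opp i e' = e'"
    and A3: "\<And>i P. directed_path (X i) P \<Longrightarrow> \<exists>u v. is_segment (\<Union>(set P)) u v"
    and A4_id: "\<And>i e' p. e' \<in> edges (X' i) \<Longrightarrow> p \<in> e' \<Longrightarrow> \<pi> i p = p"
    and A4_isometry: "\<And>i e'. e' \<in> edges (X' i) \<Longrightarrow>
      \<pi> i ` opp i e' = e' \<and>
      (\<forall>p\<in>opp i e'. \<forall>q\<in>opp i e'. dist (\<pi> i p) (\<pi> i q) = dist p q)"
    and A5: "\<exists>\<alpha>>0. \<forall>i. \<forall>e'\<in>edges (X' i). opp i e' \<noteq> e' \<longrightarrow>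
      (SUP p\<in>e'. dist p (opp_point \<pi> opp i e' p)) \<ge> \<alpha> * edge_length (X' i) e'"
    and A6: "\<exists>\<beta>>0. \<forall>i P. directed_path_from_to (X' i) v0 v1 P \<longrightarrow>
      (\<Sum>e'\<in>{e' \<in> set P. opp i e' \<noteq> e'}. edge_length (X' i) e') \<ge> \<beta>"

text \<open>Probability measures on \<open>X i\<close> live on the trace of the Borel sets of the ambient space.\<close>

definition system_measures ::
    "(nat \<Rightarrow> 'a::metric_space mgraph) \<Rightarrow> (nat \<Rightarrow> 'a mgraph) \<Rightarrow> (nat \<Rightarrow> 'a set \<Rightarrow> 'a set) \<Rightarrow>
     (nat \<Rightarrow> 'a measure) \<Rightarrow> bool" where
  "system_measures X X' opp \<mu> \<longleftrightarrow>
     (\<forall>i. prob_space (\<mu> i) \<and> sets (\<mu> i) = sets (restrict_space borel (points (X i)))) \<and>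
     (\<forall>A\<in>sets (\<mu> 0). emeasure (\<mu> 0) A = graph_length (X 0) A) \<and>
     (\<forall>i. \<forall>e\<in>edges (X (Suc i)). \<exists>c. \<forall>A\<in>sets (\<mu> (Suc i)). A \<subseteq> e \<longrightarrow>
        emeasure (\<mu> (Suc i)) A = c * graph_length (X (Suc i)) A) \<and>
     (\<forall>i. \<forall>e'\<in>edges (X' i).
        (if opp i e' = e' then measure (\<mu> (Suc i)) e' = measure (\<mu> i) e'
         else measure (\<mu> (Suc i)) e' = measure (\<mu> i) e' / 2 \<and>
              measure (\<mu> (Suc i)) (opp i e') = measure (\<mu> i) e' / 2))"

definition Delta_E :: "'a::metric_space mgraph \<Rightarrow> real" where
  "Delta_E G = Min (edge_length G ` edges G)"

definition delta_E :: "'a::metric_space mgraph \<Rightarrow> 'a mgraph \<Rightarrow> real" where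
  "delta_E G' G = Max (edge_length G' ` edges G') / Delta_E G"

definition set_distance :: "'a::metric_space set \<Rightarrow> 'a set \<Rightarrow> ennreal" where
  "set_distance A B = (INF a\<in>A. INF b\<in>B. ennreal (dist a b))"

text \<open>In \<^typ>\<open>ennreal\<close> an infimum over the empty set is \<open>\<top>\<close>, a supremum over the empty set
  is \<open>0\<close>, and \<open>x / \<top> = 0\<close> for finite \<open>x\<close>. Thus the distance to the empty set is infinite, and the
  parameter \<open>delta_d\<close> is \<open>0\<close> if there are no nonterminal subedges.\<close>

definition Delta_d :: "'a::metric_space mgraph \<Rightarrow> 'a mgraph \<Rightarrow> ennreal" where
  "Delta_d G' G =
     (INF e\<in>edges G. INF e'\<in>nonterminal_subedges G' G e. set_distance e' (points G - e))"

definition delta_d :: "'a::metric_space mgraph \<Rightarrow> 'a mgraph \<Rightarrow> ennreal" where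
  "delta_d G' G =
     (SUP e\<in>edges G. SUP e'\<in>nonterminal_subedges G' G e. ennreal (edge_length G' e'))
       / Delta_d G' G"

text \<open>\<open>proj \<pi> i j\<close> is the composition from \<open>X j\<close> to \<open>X i\<close> for \<open>i \<le> j\<close>.\<close>

primrec proj :: "(nat \<Rightarrow> 'a \<Rightarrow> 'a) \<Rightarrow> nat \<Rightarrow> nat \<Rightarrow> 'a \<Rightarrow> 'a" where
  "proj \<pi> i 0 = id"
| "proj \<pi> i (Suc j) = (if i \<le> j then proj \<pi> i j \<circ> \<pi> j else id)"

definition limit_space :: "(nat \<Rightarrow> 'a::metric_space mgraph) \<Rightarrow> 'a set" where
  "limit_space X = closure (\<Union>i. points (X i))"

text \<open>The continuous extensions of the compositions. This determines \<open>\<pi>_inf i\<close> uniquely on the limit space.\<close>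

definition limit_projections ::
    "(nat \<Rightarrow> 'a::metric_space mgraph) \<Rightarrow> (nat \<Rightarrow> 'a \<Rightarrow> 'a) \<Rightarrow> (nat \<Rightarrow> 'a \<Rightarrow> 'a) \<Rightarrow> bool" where
  "limit_projections X \<pi> \<pi>_inf \<longleftrightarrow>
     (\<forall>i. continuous_on (limit_space X) (\<pi>_inf i) \<and>
          (\<forall>j\<ge>i. \<forall>x\<in>points (X j). \<pi>_inf i x = proj \<pi> i j x))"

definition limit_measure ::
    "(nat \<Rightarrow> 'a::metric_space mgraph) \<Rightarrow> (nat \<Rightarrow> 'a \<Rightarrow> 'a) \<Rightarrow> (nat \<Rightarrow> 'a measure) \<Rightarrow>
     'a measure \<Rightarrow> bool" where
  "limit_measure X \<pi>_inf \<mu> \<mu>_inf \<longleftrightarrow>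
     prob_space \<mu>_inf \<and> sets \<mu>_inf = sets (restrict_space borel (limit_space X)) \<and>
     (\<forall>i. distr \<mu>_inf (restrict_space borel (points (X i))) (\<pi>_inf i) = \<mu> i)"

definition nonvertex ::
    "(nat \<Rightarrow> 'a::metric_space mgraph) \<Rightarrow> (nat \<Rightarrow> 'a \<Rightarrow> 'a) \<Rightarrow> 'a \<Rightarrow> bool" where
  "nonvertex X \<pi>_inf x \<longleftrightarrow> x \<in> limit_space X \<and> (\<forall>i. \<pi>_inf i x \<notin> verts (X i))"

definition edge_at ::
    "(nat \<Rightarrow> 'a mgraph) \<Rightarrow> (nat \<Rightarrow> 'a \<Rightarrow> 'a) \<Rightarrow> 'a \<Rightarrow> nat \<Rightarrow> 'a set" where
  "edge_at X \<pi>_inf x i = (THE e. e \<in> edges (X i) \<and> \<pi>_inf i x \<in> e)"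

definition scale_at ::
    "(nat \<Rightarrow> 'a::metric_space mgraph) \<Rightarrow> (nat \<Rightarrow> 'a \<Rightarrow> 'a) \<Rightarrow> 'a \<Rightarrow> nat \<Rightarrow> real" where
  "scale_at X \<pi>_inf x i = edge_length (X i) (edge_at X \<pi>_inf x i)"

text \<open>An ultrafilter is a filter in the library's sense; its members are the sets
  \<open>{n. P n}\<close> with \<open>eventually P U\<close>.\<close>

definition ultrafilter :: "'i filter \<Rightarrow> bool" where
  "ultrafilter U \<longleftrightarrow> U \<noteq> bot \<and> (\<forall>P. eventually P U \<or> eventually (\<lambda>n. \<not> P n) U)"

definition nonprincipal_ultrafilter :: "'i filter \<Rightarrow> bool" where
  "nonprincipal_ultrafilter U \<longleftrightarrow> ultrafilter U \<and> (\<forall>n. U \<noteq> principal {n})"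

definition bounded_sequences ::
    "('i \<Rightarrow> 'a set) \<Rightarrow> ('i \<Rightarrow> 'a \<Rightarrow> 'a \<Rightarrow> real) \<Rightarrow> ('i \<Rightarrow> 'a) \<Rightarrow> ('i \<Rightarrow> 'a) set" where
  "bounded_sequences M d x = {y. (\<forall>n. y n \<in> M n) \<and> (\<exists>B. \<forall>n. d n (y n) (x n) \<le> B)}"

definition ultra_rel ::
    "'i filter \<Rightarrow> ('i \<Rightarrow> 'a set) \<Rightarrow> ('i \<Rightarrow> 'a \<Rightarrow> 'a \<Rightarrow> real) \<Rightarrow> ('i \<Rightarrow> 'a) \<Rightarrow>
     (('i \<Rightarrow> 'a) \<times> ('i \<Rightarrow> 'a)) set" where
  "ultra_rel U M d x = {(y, z). y \<in> bounded_sequences M d x \<and> z \<in> bounded_sequences M d x \<and>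
     ((\<lambda>n. d n (y n) (z n)) \<longlongrightarrow> 0) U}"

definition ultralimit ::
    "'i filter \<Rightarrow> ('i \<Rightarrow> 'a set) \<Rightarrow> ('i \<Rightarrow> 'a \<Rightarrow> 'a \<Rightarrow> real) \<Rightarrow> ('i \<Rightarrow> 'a) \<Rightarrow> ('i \<Rightarrow> 'a) set set" where
  "ultralimit U M d x = bounded_sequences M d x // ultra_rel U M d x"

text \<open>The value outside of the carrier is irrelevant, but the library's notion of a metric space
  requires it to be nonnegative and symmetric.\<close>

definition ultra_dist ::
    "'i filter \<Rightarrow> ('i \<Rightarrow> 'a set) \<Rightarrow> ('i \<Rightarrow> 'a \<Rightarrow> 'a \<Rightarrow> real) \<Rightarrow> ('i \<Rightarrow> 'a) \<Rightarrow>
     ('i \<Rightarrow> 'a) set \<Rightarrow> ('i \<Rightarrow> 'a) set \<Rightarrow> real" where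
  "ultra_dist U M d x A B =
     (if A \<in> ultralimit U M d x \<and> B \<in> ultralimit U M d x
      then THE r. \<forall>y\<in>A. \<forall>z\<in>B. ((\<lambda>n. d n (y n) (z n)) \<longlongrightarrow> r) U else 0)"

lemma ultrafilter_bounded_convergent:
  fixes f :: "'i \<Rightarrow> real"
  assumes U: "ultrafilter U" and f: "\<And>n. f n \<in> {a..b}"
  shows "\<exists>l. (f \<longlongrightarrow> l) U"
proof -
  let ?F = "filtermap f U"
  have nb: "?F \<noteq> bot" using U by (simp add: ultrafilter_def filtermap_bot_iff)
  have le: "eventually (\<lambda>y. y \<in> {a..b}) ?F"
    using f by (simp add: eventually_filtermap)
  obtain l where l: "inf (nhds l) ?F \<noteq> bot"
    using compact_Icc[of a b, unfolded compact_filter, rule_format, OF nb le] by blast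
  have "(f \<longlongrightarrow> l) U"
  proof (rule topological_tendstoI)
    fix S assume S: "open S" "l \<in> S"
    show "eventually (\<lambda>n. f n \<in> S) U"
    proof (rule ccontr)
      assume "\<not> ?thesis"
      then have "eventually (\<lambda>n. f n \<notin> S) U" using U unfolding ultrafilter_def by blast
      then have "eventually (\<lambda>y. y \<notin> S) ?F" by (simp add: eventually_filtermap)
      moreover have "eventually (\<lambda>y. y \<in> S) (nhds l)" using S by (auto simp: eventually_nhds)
      ultimately have "eventually (\<lambda>y. False) (inf (nhds l) ?F)"
        unfolding eventually_inf by blast
      with l show False by (simp add: trivial_limit_def)
    qed
  qed
  then show ?thesis ..
qed

lemma Metric_space_ultralimit:
  assumes U: "ultrafilter U" and M: "\<And>n. Metric_space (M n) (d n)" and x: "\<And>n. x n \<in> M n"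
  shows "Metric_space (ultralimit U M d x) (ultra_dist U M d x)"
proof -
  let ?S = "bounded_sequences M d x" and ?R = "ultra_rel U M d x"
    and ?C = "ultralimit U M d x" and ?D = "ultra_dist U M d x"
  have nb: "U \<noteq> bot" using U by (simp add: ultrafilter_def)
  have nonneg: "0 \<le> d n y z" for n y z by (rule Metric_space.nonneg[OF M])
  have comm: "d n y z = d n z y" for n y z by (rule Metric_space.commute[OF M])
  have tri: "d n (u n) (w n) \<le> d n (u n) (v n) + d n (v n) (w n)"
    if "u \<in> ?S" "v \<in> ?S" "w \<in> ?S" for n u v w
    using Metric_space.triangle[OF M] that unfolding bounded_sequences_def by blast
  have xS: "x \<in> ?S"
    unfolding bounded_sequences_def
  proof (intro CollectI conjI allI exI)
    fix n show "x n \<in> M n" by (rule x)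
    show "d n (x n) (x n) \<le> 0" using Metric_space.zero[OF M] x by (metis order_refl)
  qed
  have conv: "\<exists>l. ((\<lambda>n. d n (y n) (z n)) \<longlongrightarrow> l) U" if y: "y \<in> ?S" and z: "z \<in> ?S" for y z
  proof -
    obtain B where B: "\<And>n. d n (y n) (x n) \<le> B" using y unfolding bounded_sequences_def by blast
    obtain C where C: "\<And>n. d n (z n) (x n) \<le> C" using z unfolding bounded_sequences_def by blast
    have "d n (y n) (z n) \<in> {0..B + C}" for n
      using tri[OF y xS z, of n] B[of n] C[of n] comm[of n "x n" "z n"] nonneg[of n] by auto
    then show ?thesis by (rule ultrafilter_bounded_convergent[OF U])
  qed
  have trans0: "((\<lambda>n. d n (u n) (w n)) \<longlongrightarrow> 0) U"
    if "u \<in> ?S" "v \<in> ?S" "w \<in> ?S" "((\<lambda>n. d n (u n) (v n)) \<longlongrightarrow> 0) U"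
       "((\<lambda>n. d n (v n) (w n)) \<longlongrightarrow> 0) U" for u v w
    by (rule tendsto_sandwich[OF _ _ tendsto_const tendsto_add_zero[OF that(4,5)]])
       (auto simp: nonneg tri that)
  have eq: "equiv ?S ?R"
  proof (rule equivI)
    show "?R \<subseteq> ?S \<times> ?S" unfolding ultra_rel_def by blast
    show "refl_on ?S ?R"
    proof (rule refl_onI)
      fix y assume y: "y \<in> ?S"
      then have "d n (y n) (y n) = 0" for n
        using Metric_space.zero[OF M] unfolding bounded_sequences_def by blast
      with y show "(y, y) \<in> ?R" unfolding ultra_rel_def by simp
    qed
    show "sym ?R"
    proof (rule symI)
      fix y z assume "(y, z) \<in> ?R"
      moreover have "(\<lambda>n. d n (z n) (y n)) = (\<lambda>n. d n (y n) (z n))" by (rule ext) (rule comm)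
      ultimately show "(z, y) \<in> ?R" unfolding ultra_rel_def by simp
    qed
    show "trans ?R" 
    proof (rule transI)
      fix u v w assume "(u, v) \<in> ?R" "(v, w) \<in> ?R"
      then show "(u, w) \<in> ?R"
        unfolding ultra_rel_def mem_Collect_eq case_prod_conv using trans0[of u v w] by blast
    qed
  qed
  have D: "((\<lambda>n. d n (y n) (z n)) \<longlongrightarrow> ?D A B) U"
    if AB: "A \<in> ?C" "B \<in> ?C" and yz: "y \<in> A" "z \<in> B" for A B y z
  proof -
    have sub: "A \<subseteq> ?S" "B \<subseteq> ?S"
      using AB in_quotient_imp_subset[OF eq] unfolding ultralimit_def by auto
    then have yS: "y \<in> ?S" and zS: "z \<in> ?S" using yz by auto
    obtain r where r: "((\<lambda>n. d n (y n) (z n)) \<longlongrightarrow> r) U" using conv[OF yS zS] by blast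
    have all: "((\<lambda>n. d n (y' n) (z' n)) \<longlongrightarrow> r) U" if y': "y' \<in> A" and z': "z' \<in> B" for y' z'
    proof -
      have S': "y' \<in> ?S" "z' \<in> ?S" using sub y' z' by auto
      have "(y', y) \<in> ?R" "(z', z) \<in> ?R"
        using quotient_eq_iff[OF eq] AB yz y' z' unfolding ultralimit_def by blast+
      then have l: "((\<lambda>n. d n (y' n) (y n)) \<longlongrightarrow> 0) U" "((\<lambda>n. d n (z' n) (z n)) \<longlongrightarrow> 0) U"
        unfolding ultra_rel_def by auto
      have lim0: "((\<lambda>n. d n (y' n) (y n) + d n (z' n) (z n)) \<longlongrightarrow> 0) U"
        using tendsto_add_zero[OF l] .
      have "\<bar>d n (y' n) (z' n) - d n (y n) (z n)\<bar> \<le> d n (y' n) (y n) + d n (z' n) (z n)" for n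
        using tri[OF S'(1) yS S'(2), of n] tri[OF yS zS S'(2), of n] tri[OF yS S'(1) zS, of n]
          tri[OF S'(1) S'(2) zS, of n] comm[of n "z n" "z' n"] comm[of n "y n" "y' n"] by linarith
      then have "((\<lambda>n. d n (y' n) (z' n) - d n (y n) (z n)) \<longlongrightarrow> 0) U"
        by (intro Lim_null_comparison[OF _ lim0] always_eventually) simp
      from tendsto_add[OF this r] show ?thesis by simp
    qed
    have "?D A B = r"
      unfolding ultra_dist_def if_P[OF conjI[OF AB]]
    proof (rule the_equality)
      show "\<forall>y\<in>A. \<forall>z\<in>B. ((\<lambda>n. d n (y n) (z n)) \<longlongrightarrow> r) U"
        by (intro ballI all)
      fix r' assume "\<forall>y\<in>A. \<forall>z\<in>B. ((\<lambda>n. d n (y n) (z n)) \<longlongrightarrow> r') U"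
      from tendsto_unique[OF nb bspec[OF bspec[OF this yz(1)] yz(2)] r] show "r' = r" .
    qed
    then show ?thesis using r by simp
  qed
  have ne: "\<exists>y\<in>?S. y \<in> A" if "A \<in> ?C" for A
    using that in_quotient_imp_non_empty[OF eq] in_quotient_imp_subset[OF eq]
    unfolding ultralimit_def by blast
  have sub: "y \<in> ?S" if "A \<in> ?C" "y \<in> A" for A y
    using that in_quotient_imp_subset[OF eq] unfolding ultralimit_def by blast
  show ?thesis
  proof
    fix A B
    show "0 \<le> ?D A B"
    proof (cases "A \<in> ?C \<and> B \<in> ?C")
      case True
      then obtain y z where "y \<in> A" "z \<in> B" using ne by meson
      with True have "((\<lambda>n. d n (y n) (z n)) \<longlongrightarrow> ?D A B) U" by (intro D) auto
      then show ?thesis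
        by (rule tendsto_lowerbound) (use nb in \<open>simp_all add: nonneg\<close>)
    qed (auto simp: ultra_dist_def)
    show "?D A B = ?D B A"
    proof (cases "A \<in> ?C \<and> B \<in> ?C")
      case True
      then obtain y z where yz: "y \<in> A" "z \<in> B" using ne by meson
      have l1: "((\<lambda>n. d n (y n) (z n)) \<longlongrightarrow> ?D A B) U"
        by (rule D) (use True yz in auto)
      have l2: "((\<lambda>n. d n (z n) (y n)) \<longlongrightarrow> ?D B A) U"
        by (rule D) (use True yz in auto)
      have "(\<lambda>n. d n (z n) (y n)) = (\<lambda>n. d n (y n) (z n))" by (rule ext) (rule comm)
      with l2 have "((\<lambda>n. d n (y n) (z n)) \<longlongrightarrow> ?D B A) U" by simp
      from tendsto_unique[OF nb l1 this] show ?thesis .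
    qed (auto simp: ultra_dist_def)
  next
    fix A B assume AB: "A \<in> ?C" "B \<in> ?C"
    then obtain y z where yz: "y \<in> A" "z \<in> B" using ne by meson
    have lim: "((\<lambda>n. d n (y n) (z n)) \<longlongrightarrow> ?D A B) U" by (rule D[OF AB yz])
    have "A = B \<longleftrightarrow> (y, z) \<in> ?R"
      using quotient_eq_iff[OF eq] AB yz unfolding ultralimit_def by blast
    also have "\<dots> \<longleftrightarrow> ((\<lambda>n. d n (y n) (z n)) \<longlongrightarrow> 0) U"
      unfolding ultra_rel_def using sub AB yz by auto
    also have "\<dots> \<longleftrightarrow> ?D A B = 0"
    proof
      assume "((\<lambda>n. d n (y n) (z n)) \<longlongrightarrow> 0) U"
      from tendsto_unique[OF nb lim this] show "?D A B = 0" .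
    next
      assume "?D A B = 0" with lim show "((\<lambda>n. d n (y n) (z n)) \<longlongrightarrow> 0) U" by simp
    qed
    finally show "(?D A B = 0) = (A = B)" by blast
  next
    fix A B C assume ABC: "A \<in> ?C" "B \<in> ?C" "C \<in> ?C"
    then obtain u v w where uvw: "u \<in> A" "v \<in> B" "w \<in> C" using ne by meson
    show "?D A C \<le> ?D A B + ?D B C"
    proof (rule tendsto_le[OF nb])
      show "((\<lambda>n. d n (u n) (v n) + d n (v n) (w n)) \<longlongrightarrow> ?D A B + ?D B C) U"
        by (intro tendsto_add D ABC uvw)
      show "((\<lambda>n. d n (u n) (w n)) \<longlongrightarrow> ?D A C) U" by (intro D ABC uvw)
      show "\<forall>\<^sub>F n in U. d n (u n) (w n) \<le> d n (u n) (v n) + d n (v n) (w n)"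
        by (intro always_eventually allI tri) (use sub ABC uvw in blast)+
    qed
  qed
qed

text \<open>For \<open>x \<in> A\<close>, \<open>r i > 0\<close> and an ultrafilter \<open>U\<close>, the lemma above shows that the two arguments
  of \<open>Metric_space.mtopology\<close> form a metric space.\<close>

definition tangent_cone_topology ::
    "'a::metric_space set \<Rightarrow> 'a \<Rightarrow> ('i \<Rightarrow> real) \<Rightarrow> 'i filter \<Rightarrow> ('i \<Rightarrow> 'a) set topology" where
  "tangent_cone_topology A x r U =
     (let d = (\<lambda>i p q. dist p q / r i)
      in Metric_space.mtopology (ultralimit U (\<lambda>i. A) d (\<lambda>i. x)) (ultra_dist U (\<lambda>i. A) d (\<lambda>i. x)))"

end

theory Submission
  imports Defs
begin

text \<open>Let \<open>x\<close> be such that \<open>\<pi>_inf i x\<close> lies in a circle edge \<open>e'\<close> of \<open>X' i\<close> for infinitely many \<open>i\<close>. For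
  these \<open>i\<close> the circle \<open>e' \<union> opp i e'\<close> consists of two geodesics of length \<open>r = scale_at X \<pi>_inf x (Suc i)\<close>
  with common ends, it lies within distance \<open>4 * r\<close> of \<open>x\<close>, and by (A5) the two geodesics are
  \<open>\<alpha> * r / 2\<close> apart somewhere. Along an ultrafilter containing these indices they converge to two
  different unit geodesics with common ends in the tangent cone, which no subset of the line contains.

  Such \<open>x\<close> have positive measure: the \<open>\<mu> i\<close>-measure of the union of the circle edges is the average,
  over a random directed path from \<open>v0\<close> to \<open>v1\<close>, of the length of the circle edges on the path, hence
  at least \<open>\<beta>\<close> by (A6), and these events for all \<open>i\<close> live on one probability space.\<close>

section \<open>Segments and subdivisions\<close>

text \<open>The metric is ambient, not a path metric, so points of an edge are compared through the
  coordinate \<open>dist (src G e) p\<close>, and the two limit curves are defined parameter by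
  parameter as classes of sequences. The scale is read at level \<open>Suc i\<close> because both
  sides of the circle over \<open>e'\<close> are edges of \<open>X (Suc i)\<close>: whichever of
  them contains the projection of \<open>x\<close>, its length is that of \<open>e'\<close>, so the
  rescaled sides have length exactly 1. The factor 4 is 1 + 1 + 2: from a point of the circle to the
  common source, from there to the projection of \<open>x\<close>, and from the projection to
  \<open>x\<close>. The last 2 is a geometric series, since \<open>delta_E\<close> at most 1/2 at
  least halves the shortest edge at each level. The quotient
  \<open>measure (\<mu> i) e / edge_length G e\<close> is the probability that the random path runs
  through \<open>e\<close>: it starts as 1, is inherited by subedges, and is halved on each side of
  a circle. Circle events of different levels may be dependent, but a limit superior of events of
  probability at least \<beta> again has probability at least \<beta>. The levels at which
  \<open>x\<close> lies over a circle depend on \<open>x\<close>, and with them the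
  ultrafilter.\<close>

lemma is_segmentE:
  assumes "is_segment A u v"
  obtains \<phi> where "0 < dist u v" "\<phi> 0 = u" "\<phi> (dist u v) = v" "\<phi> ` {0..dist u v} = A"
    "\<And>s t. s \<in> {0..dist u v} \<Longrightarrow> t \<in> {0..dist u v} \<Longrightarrow> dist (\<phi> s) (\<phi> t) = \<bar>s - t\<bar>"
proof -
  obtain l \<phi> where l: "l > 0" and g: "geodesic 0 l u v \<phi>" and im: "\<phi> ` {0..l} = A"
    using assms unfolding is_segment_def by blast
  have "dist u v = \<bar>0 - l\<bar>"
    using g l unfolding geodesic_def by (metis atLeastAtMost_iff order_refl less_imp_le)
  then have "l = dist u v" using l by simp
  then show thesis using that[of \<phi>] l g im unfolding geodesic_def by auto
qed

text \<open>The distance to the first end is an arc length coordinate; it reduces all later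
  statements on segments to real numbers.\<close>

lemma segment_dist:
  assumes "is_segment A u v" "p \<in> A" "q \<in> A"
  shows "dist p q = \<bar>dist u p - dist u q\<bar>"
proof -
  obtain \<phi> where \<phi>: "0 < dist u v" "\<phi> 0 = u" "\<phi> ` {0..dist u v} = A"
    "\<And>s t. s \<in> {0..dist u v} \<Longrightarrow> t \<in> {0..dist u v} \<Longrightarrow> dist (\<phi> s) (\<phi> t) = \<bar>s - t\<bar>"
    using is_segmentE[OF assms(1)] by metis
  obtain s t where st: "s \<in> {0..dist u v}" "t \<in> {0..dist u v}" "p = \<phi> s" "q = \<phi> t"
    using \<phi>(3) assms by blast
  have "dist u p = s" "dist u q = t"
    using \<phi>(4)[of 0 s] \<phi>(4)[of 0 t] \<phi>(1,2) st by auto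
  then show ?thesis using \<phi>(4)[OF st(1,2)] st by simp
qed

lemma segment_image:
  assumes "is_segment A u v"
  shows "dist u ` A = {0..dist u v}"
proof -
  obtain \<phi> where \<phi>: "0 < dist u v" "\<phi> 0 = u" "\<phi> ` {0..dist u v} = A"
    "\<And>s t. s \<in> {0..dist u v} \<Longrightarrow> t \<in> {0..dist u v} \<Longrightarrow> dist (\<phi> s) (\<phi> t) = \<bar>s - t\<bar>"
    using is_segmentE[OF assms(1)] by metis
  have "dist u (\<phi> s) = s" if "s \<in> {0..dist u v}" for s
    using \<phi>(4)[of 0 s] \<phi>(1,2) that by auto
  then have "dist u ` \<phi> ` {0..dist u v} = (\<lambda>s. s) ` {0..dist u v}"
    unfolding image_image by (intro image_cong) auto
  then show ?thesis using \<phi>(3) by simp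
qed

lemma segment_length_pos: "is_segment A u v \<Longrightarrow> 0 < dist u v"
  by (rule is_segmentE)

lemma segment_ends: "is_segment A u v \<Longrightarrow> u \<in> A \<and> v \<in> A"
  by (erule is_segmentE) (metis atLeastAtMost_iff imageI less_imp_le order_refl)

lemma segment_dist_le: "is_segment A u v \<Longrightarrow> p \<in> A \<Longrightarrow> dist u p \<le> dist u v"
  using segment_image by fastforce

lemma segment_point:
  assumes "is_segment A u v" "0 \<le> t" "t \<le> dist u v"
  obtains p where "p \<in> A" "dist u p = t"
proof -
  have "t \<in> dist u ` A" using segment_image[OF assms(1)] assms by simp
  then show thesis using that by blast
qed

lemma segment_eqI:
  assumes "is_segment A u v" "p \<in> A" "q \<in> A" "dist u p = dist u q"
  shows "p = q"
  using segment_dist[OF assms(1-3)] assms(4) by simp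

lemma segment_compact:
  assumes "is_segment A u v"
  shows "compact A"
proof -
  obtain \<phi> where \<phi>: "\<phi> ` {0..dist u v} = A"
    "\<And>s t. s \<in> {0..dist u v} \<Longrightarrow> t \<in> {0..dist u v} \<Longrightarrow> dist (\<phi> s) (\<phi> t) = \<bar>s - t\<bar>"
    using is_segmentE[OF assms(1)] by metis
  have "continuous_on {0..dist u v} \<phi>"
    unfolding continuous_on_iff using \<phi>(2) by (metis dist_real_def)
  then show ?thesis using \<phi>(1) compact_continuous_image compact_Icc by blast
qed

text \<open>Distinct edges share only finitely many points, so infinitude is what prevents an edge
  from lying in two of them.\<close>

lemma segment_infinite:
  assumes "is_segment A u v"
  shows "infinite A"
proof
  assume "finite A"
  then have "finite {0..dist u v}" using segment_image[OF assms] by (metis finite_imageI)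
  then show False using segment_length_pos[OF assms] infinite_Icc by blast
qed

text \<open>Since \<open>p\<close> is metrically between \<open>s\<close> and \<open>t\<close>, so
  is its coordinate; the assumption on the coordinates of \<open>s\<close> and \<open>t\<close>
  excludes the reversed traversal of \<open>B\<close>.\<close>

lemma subsegment_dist:
  assumes A: "is_segment A u v" and B: "is_segment B s t" "B \<subseteq> A"
    and st: "dist u s < dist u t" and p: "p \<in> B"
  shows "dist u p = dist u s + dist s p"
proof -
  have mem: "s \<in> A" "t \<in> A" "p \<in> A" "t \<in> B" using segment_ends[OF B(1)] B(2) p by auto
  have "dist s p = \<bar>dist u s - dist u p\<bar>" "dist t p = \<bar>dist u t - dist u p\<bar>"
    "dist s t = \<bar>dist u s - dist u t\<bar>"
    by (intro segment_dist[OF A] mem)+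
  moreover have "dist t p = \<bar>dist s t - dist s p\<bar>" "dist s p \<le> dist s t"
    by (intro segment_dist[OF B(1)] segment_dist_le[OF B(1)] mem p)+
  ultimately show ?thesis using st by linarith
qed

lemma subsegment_image:
  assumes A: "is_segment A u v" and B: "is_segment B s t" "B \<subseteq> A"
    and st: "dist u s < dist u t"
  shows "dist u ` B = {dist u s..dist u s + dist s t}"
proof -
  have "dist u ` B = (\<lambda>p. dist u s + dist s p) ` B"
    using subsegment_dist[OF A B st] by (intro image_cong) auto
  also have "\<dots> = (+) (dist u s) ` (dist s ` B)" by (simp add: image_image)
  also have "\<dots> = {dist u s..dist u s + dist s t}"
    unfolding segment_image[OF B(1)] by simp
  finally show ?thesis .
qed

section \<open>Edges of metric graphs and of their subdivisions\<close>

lemma graph_edge_segment: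
  "directed_metric_graph G \<Longrightarrow> e \<in> edges G \<Longrightarrow> is_segment e (src G e) (snk G e)"
  unfolding directed_metric_graph_def by blast

lemma edge_length_pos:
  "directed_metric_graph G \<Longrightarrow> e \<in> edges G \<Longrightarrow> 0 < edge_length G e"
  unfolding edge_length_def by (rule segment_length_pos[OF graph_edge_segment])

lemma graph_edge_verts:
  "directed_metric_graph G \<Longrightarrow> e \<in> edges G \<Longrightarrow> e \<inter> verts G = {src G e, snk G e}"
  unfolding directed_metric_graph_def by blast

lemma graph_edges_Int:
  "directed_metric_graph G \<Longrightarrow> e \<in> edges G \<Longrightarrow> f \<in> edges G \<Longrightarrow> e \<noteq> f \<Longrightarrow> e \<inter> f \<subseteq> verts G"
  unfolding directed_metric_graph_def by blast

lemma graph_finite: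
  "directed_metric_graph G \<Longrightarrow> finite (verts G) \<and> finite (edges G)"
  unfolding directed_metric_graph_def by blast

lemma graph_edges_Int_finite:
  "directed_metric_graph G \<Longrightarrow> e \<in> edges G \<Longrightarrow> f \<in> edges G \<Longrightarrow> e \<noteq> f \<Longrightarrow> finite (e \<inter> f)"
  using graph_edges_Int graph_finite finite_subset by metis

lemma graph_compact: "directed_metric_graph G \<Longrightarrow> compact (points G)"
  unfolding points_def using graph_finite graph_edge_segment segment_compact
  by (intro compact_Union) blast+

lemma edge_subset_points: "e \<in> edges G \<Longrightarrow> e \<subseteq> points G"
  unfolding points_def by blast

lemma subdivision_graph: "directed_subdivision G' G \<Longrightarrow> directed_metric_graph G'"
  unfolding directed_subdivision_def by blast

lemma subdivision_parent_unique:
  assumes "directed_metric_graph G" "directed_metric_graph G'"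
    and "subedge G' G e' e" "subedge G' G e' f"
  shows "e = f"
proof (rule ccontr)
  assume ne: "e \<noteq> f"
  have "finite (e \<inter> f)" "e' \<subseteq> e \<inter> f" "e' \<in> edges G'"
    using graph_edges_Int_finite[OF assms(1) _ _ ne] assms(3,4) unfolding subedge_def by auto
  then show False
    using segment_infinite[OF graph_edge_segment[OF assms(2)]] finite_subset by blast
qed

lemma subdivision_oriented:
  assumes G: "directed_metric_graph G" and sub: "directed_subdivision G' G" and e: "subedge G' G e' e"
  shows "dist (src G e) (src G' e') < dist (src G e) (snk G' e')"
proof -
  have "e' \<in> edges G'" using e unfolding subedge_def by blast
  then obtain f where "subedge G' G e' f" "dist (src G f) (src G' e') < dist (src G f) (snk G' e')"
    using sub unfolding directed_subdivision_def by blast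
  then show ?thesis using subdivision_parent_unique[OF G subdivision_graph[OF sub] e] by blast
qed

text \<open>A subdivision is only known to have the same points as \<open>G\<close>, so the edge
  leaving \<open>v\<close> has to be found. Points of \<open>e\<close> tending to \<open>v\<close>
  from beyond it lie in finitely many edges of \<open>G'\<close>; one of these contains infinitely
  many of them, and also \<open>v\<close> because it is closed.\<close>

lemma subdivision_next_edge:
  assumes G: "directed_metric_graph G" and sub: "directed_subdivision G' G"
    and e: "e \<in> edges G" and v: "v \<in> verts G'" "v \<in> e" "v \<noteq> snk G e"
  obtains e' where "subedge G' G e' e" "src G' e' = v"
proof -
  let ?d = "dist (src G e)"
  note G' = subdivision_graph[OF sub] and seg = graph_edge_segment[OF G e]
  have lt: "?d v < ?d (snk G e)"
    using segment_dist_le[OF seg v(2)] segment_eqI[OF seg v(2) segment_ends[OF seg, THEN conjunct2]]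
      v(3) by fastforce
  define W where "W = {p \<in> e. ?d v < ?d p}"
  \<comment> \<open>Coordinates of the chosen points: strictly beyond \<open>v\<close>, still inside
    \<open>e\<close>, and tending to the coordinate of \<open>v\<close>.\<close>
  define a where "a n = ?d v + (?d (snk G e) - ?d v) * inverse (real (Suc n))" for n
  have a: "?d v < a n" "a n \<le> ?d (snk G e)" for n
  proof -
    show "?d v < a n" unfolding a_def using lt by (simp add: field_simps)
    have "(?d (snk G e) - ?d v) * inverse (real (Suc n)) \<le> (?d (snk G e) - ?d v) * 1"
      using lt by (intro mult_left_mono) (auto simp: field_simps)
    then show "a n \<le> ?d (snk G e)" unfolding a_def by simp
  qed
  have "\<exists>p\<in>e. ?d p = a n" for n
    using segment_point[OF seg] a[of n] by (metis less_imp_le order_trans zero_le_dist)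
  then obtain p where p: "\<And>n. p n \<in> e" "\<And>n. ?d (p n) = a n" by metis
  have "\<exists>f\<in>edges G'. p n \<in> f" for n
  proof -
    have "p n \<in> points G'"
      using sub p(1)[of n] e unfolding directed_subdivision_def points_def by blast
    then show ?thesis unfolding points_def by blast
  qed
  then obtain f where f: "\<And>n. f n \<in> edges G'" "\<And>n. p n \<in> f n" by metis
  have "finite (range f)" using f(1) graph_finite[OF G'] by (auto intro: finite_subset[of _ "edges G'"])
  then obtain n0 where inf: "infinite {n. f n = f n0}"
    using pigeonhole_infinite[of UNIV f] by auto
  define e' where "e' = f n0"
  define N where "N = {n. f n = f n0}"
  have e': "e' \<in> edges G'" "\<And>n. n \<in> N \<Longrightarrow> p n \<in> e'" unfolding e'_def N_def using f by auto
  have N: "infinite N" using inf N_def by simp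
  have inj: "inj p"
  proof (rule injI)
    fix m n assume "p m = p n"
    then have "a m = a n" using p(2) by metis
    then show "m = n" unfolding a_def using lt by simp
  qed
  have "(\<lambda>n. a n - ?d v) \<longlonglongrightarrow> 0"
    using tendsto_mult[OF tendsto_const LIMSEQ_inverse_real_of_nat, of "?d (snk G e) - ?d v"]
    unfolding a_def by simp
  moreover have "dist (p n) v = a n - ?d v" for n
    using segment_dist[OF seg p(1)[of n] v(2)] p(2)[of n] a(1)[of n] by simp
  ultimately have "p \<longlonglongrightarrow> v" by (simp add: tendsto_dist_iff[of p])
  have ve': "v \<in> e'"
  proof (rule ccontr)
    assume "v \<notin> e'"
    moreover have "closed e'"
      using segment_compact[OF graph_edge_segment[OF G' e'(1)]] compact_imp_closed by blast
    ultimately have "eventually (\<lambda>n. p n \<in> - e') sequentially"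
      using topological_tendstoD[OF \<open>p \<longlonglongrightarrow> v\<close>, of "- e'"] by (simp add: open_Compl)
    then obtain m where m: "\<And>n. n \<ge> m \<Longrightarrow> p n \<in> - e'"
      unfolding eventually_sequentially by blast
    have "n < m" if "n \<in> N" for n using e'(2)[OF that] m[of n] by (cases "n < m") auto
    then have "finite N" by (auto intro: finite_subset[of _ "{..<m}"])
    with N show False by simp
  qed
  obtain g where g: "subedge G' G e' g" using sub e'(1) unfolding directed_subdivision_def by blast
  \<comment> \<open>The parent \<open>g\<close> of the new edge shares with \<open>e\<close> all
    \<open>p n\<close> with \<open>n \<in> N\<close>, too many for two distinct edges.\<close>
  have "g = e"
  proof (rule ccontr)
    assume "g \<noteq> e"
    then have "finite (g \<inter> e)" using graph_edges_Int_finite[OF G] g e unfolding subedge_def by blast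
    moreover have "p ` N \<subseteq> g \<inter> e" using e'(2) p(1) g unfolding subedge_def by blast
    ultimately show False
      using N finite_subset finite_imageD[OF _ inj_on_subset[OF inj subset_UNIV]] by blast
  qed
  have "v \<in> {src G' e', snk G' e'}" using graph_edge_verts[OF G' e'(1)] ve' v(1) by blast
  \<comment> \<open>If \<open>v\<close> were the sink, the orientation would put all of
    \<open>e'\<close> at coordinates at most that of \<open>v\<close>, but the \<open>p n\<close>
    lie beyond.\<close>
  moreover have "v \<noteq> snk G' e'"
  proof
    assume vs: "v = snk G' e'"
    obtain n where n: "n \<in> N" using N by fastforce
    note seg' = graph_edge_segment[OF G' e'(1)]
    have "e' \<subseteq> e" using g unfolding \<open>g = e\<close> subedge_def by blast
    note sd = subsegment_dist[OF seg seg' this subdivision_oriented[OF G sub g[unfolded \<open>g = e\<close>]]]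
    have "?d (p n) \<le> ?d (snk G' e')"
      using sd[OF e'(2)[OF n]] sd[OF segment_ends[OF seg', THEN conjunct2]]
        segment_dist_le[OF seg' e'(2)[OF n]] by linarith
    then show False using a(1)[of n] p(2)[of n] vs by simp
  qed
  ultimately show thesis using that g \<open>g = e\<close> by blast
qed

text \<open>Induction on the number of vertices farther from \<open>src G e\<close> than
  \<open>v\<close>. The lower bound on the sources is carried along because it keeps the first edge
  out of the rest of the chain, which makes the chain distinct.\<close>

lemma subdivision_chain_from:
  assumes G: "directed_metric_graph G" and sub: "directed_subdivision G' G"
    and e: "e \<in> edges G" and v: "v \<in> verts G'" "v \<in> e" "v \<noteq> snk G e"
  shows "\<exists>Q. directed_path_from_to G' v (snk G e) Q \<and> distinct Q \<and>
    (\<forall>f\<in>set Q. subedge G' G f e \<and> dist (src G e) v \<le> dist (src G e) (src G' f))"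
  using v
proof (induction "card {w \<in> verts G'. dist (src G e) v < dist (src G e) w}" arbitrary: v
    rule: less_induct)
  case less
  let ?d = "dist (src G e)"
  note G' = subdivision_graph[OF sub]
  obtain e' where e': "subedge G' G e' e" "src G' e' = v"
    using subdivision_next_edge[OF G sub e less.prems] by blast
  define w where "w = snk G' e'"
  have w: "w \<in> verts G'" "w \<in> e"
    using graph_edge_verts[OF G', of e'] e' unfolding w_def subedge_def by auto
  have vw: "?d v < ?d w" using subdivision_oriented[OF G sub e'(1)] e'(2) w_def by simp
  show ?case
  proof (cases "w = snk G e")
    case True
    show ?thesis
      by (rule exI[of _ "[e']"])
        (use e' True in \<open>auto simp: directed_path_from_to_def directed_path_def subedge_def w_def\<close>)
  next
    case False
    have "{x \<in> verts G'. ?d w < ?d x} \<subset> {x \<in> verts G'. ?d v < ?d x}" using vw w by auto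
    then have "card {x \<in> verts G'. ?d w < ?d x} < card {x \<in> verts G'. ?d v < ?d x}"
      using graph_finite[OF G'] by (intro psubset_card_mono) auto
    from less.hyps[OF this w False] obtain Q where Q: "directed_path_from_to G' w (snk G e) Q"
      "distinct Q" "\<And>f. f \<in> set Q \<Longrightarrow> subedge G' G f e \<and> ?d w \<le> ?d (src G' f)" by blast
    have "e' \<notin> set Q" using Q(3)[of e'] vw e'(2) by auto
    moreover have "directed_path_from_to G' v (snk G e) (e' # Q)"
      using Q(1) e' unfolding directed_path_from_to_def directed_path_def subedge_def w_def
      by (auto simp: nth_Cons hd_conv_nth split: nat.split)
    ultimately show ?thesis using Q e' vw by (intro exI[of _ "e' # Q"]) force
  qed
qed

lemma subdivision_chain:
  assumes G: "directed_metric_graph G" and sub: "directed_subdivision G' G" and e: "e \<in> edges G"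
  obtains Q where "directed_path_from_to G' (src G e) (snk G e) Q" "distinct Q"
    "\<And>f. f \<in> set Q \<Longrightarrow> subedge G' G f e"
proof -
  have "src G e \<in> verts G'" "src G e \<in> e" "src G e \<noteq> snk G e"
    using graph_edge_verts[OF G e] sub segment_length_pos[OF graph_edge_segment[OF G e]]
    unfolding directed_subdivision_def by auto
  from subdivision_chain_from[OF G sub e this] show thesis using that by blast
qed

section \<open>Ultralimits containing two geodesics\<close>

text \<open>A minimal proper filter is an ultrafilter: meeting it with a predicate gives either
  \<open>bot\<close> or the filter itself. Minimal ones exist below \<open>F\<close> because
  something eventually true for the infimum of a chain is already eventually true for a member, so
  the infimum stays proper.\<close>

lemma ultrafilter_refines:
  assumes F: "F \<noteq> bot"
  obtains U where "ultrafilter U" "U \<le> F"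
proof -
  define A where "A = {G. G \<noteq> bot \<and> G \<le> F}"
  \<comment> \<open>Zorn's lemma for the reversed order, in which smaller filters are the larger
    elements.\<close>
  have "\<exists>m\<in>A. \<forall>a\<in>A. a \<le> m \<longrightarrow> a = m"
  proof (rule predicate_Zorn)
    show "partial_order_on A (relation_of (\<lambda>a b. b \<le> a) A)"
      by (rule partial_order_on_relation_ofI) auto
  next
    fix C assume C: "C \<in> Chains (relation_of (\<lambda>a b. b \<le> a) A)"
    have CA: "C \<subseteq> A" by (rule Chains_relation_of[OF C])
    have tot: "G \<le> H \<or> H \<le> G" if "G \<in> C" "H \<in> C" for G H
      using C that unfolding Chains_def relation_of_def by blast
    show "\<exists>u\<in>A. \<forall>a\<in>C. u \<le> a"
    proof (cases "C = {}")
      case True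
      then show ?thesis using F unfolding A_def by blast
    next
      case False
      have "\<exists>G\<in>C. G \<le> inf H K" if "H \<in> C" "K \<in> C" for H K
        using tot[OF that] that by (metis inf.absorb1 inf.absorb2 order_refl)
      then have ev: "eventually P (Inf C) \<longleftrightarrow> (\<exists>G\<in>C. eventually P G)" for P
        by (rule eventually_Inf_base[OF False])
      have "Inf C \<noteq> bot"
      proof
        assume "Inf C = bot"
        then obtain G where "G \<in> C" "eventually (\<lambda>_. False) G"
          using ev[of "\<lambda>_. False"] by auto
        then show False using CA unfolding A_def by auto
      qed
      moreover obtain G where "G \<in> C" "G \<le> F" using False CA unfolding A_def by blast
      then have "Inf C \<le> F" by (rule Inf_lower2)
      ultimately show ?thesis unfolding A_def by (intro bexI[of _ "Inf C"]) (auto intro: Inf_lower)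
    qed
  qed
  then obtain U where U: "U \<noteq> bot" "U \<le> F" and min: "\<And>G. G \<noteq> bot \<Longrightarrow> G \<le> U \<Longrightarrow> G = U"
    unfolding A_def by (blast intro: order_trans)
  have "eventually P U \<or> eventually (\<lambda>n. \<not> P n) U" for P
  proof (cases "inf U (principal {n. P n}) = bot")
    case True
    then have "eventually (\<lambda>_. False) (inf U (principal {n. P n}))" by simp
    then show ?thesis by (simp add: eventually_inf_principal)
  next
    case False
    then have "inf U (principal {n. P n}) = U" by (rule min) simp
    then have "U \<le> principal {n. P n}" by (metis inf.cobounded2)
    then show ?thesis by (simp add: le_principal)
  qed
  then show thesis using that U unfolding ultrafilter_def by blast
qed

text \<open>Refining \<open>sequentially\<close> excludes principal filters, as every tail belongs
  to the ultrafilter; the infinitude of \<open>I\<close> is what makes the trace of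
  \<open>sequentially\<close> on \<open>I\<close> proper.\<close>

lemma nonprincipal_ultrafilter_containing:
  fixes I :: "nat set"
  assumes "infinite I"
  obtains U where "nonprincipal_ultrafilter U" "eventually (\<lambda>n. n \<in> I) U"
proof -
  have "inf sequentially (principal I) \<noteq> bot"
  proof
    assume "inf sequentially (principal I) = bot"
    then have "eventually (\<lambda>_. False) (inf sequentially (principal I))" by simp
    then have "eventually (\<lambda>n. n \<notin> I) sequentially" by (simp add: eventually_inf_principal)
    then obtain m where m: "\<And>n. n \<ge> m \<Longrightarrow> n \<notin> I" unfolding eventually_sequentially by blast
    have "n < m" if "n \<in> I" for n using m[of n] that by (cases "n < m") auto
    then have "I \<subseteq> {..<m}" by blast
    then show False using assms finite_subset by blast
  qed
  then obtain U where U: "ultrafilter U" "U \<le> inf sequentially (principal I)"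
    by (rule ultrafilter_refines)
  have "U \<noteq> principal {n}" for n
  proof
    assume "U = principal {n}"
    moreover have "eventually (\<lambda>k. n < k) U"
      using U(2) eventually_gt_at_top[of n] unfolding le_inf_iff by (meson filter_leD)
    ultimately show False by (simp add: eventually_principal)
  qed
  moreover have "eventually (\<lambda>n. n \<in> I) U" using U(2) by (simp add: le_principal)
  ultimately show thesis using that U(1) unfolding nonprincipal_ultrafilter_def by blast
qed

lemma ultralimit_classI:
  assumes "y \<in> bounded_sequences M d x"
  shows "ultra_rel U M d x `` {y} \<in> ultralimit U M d x"
  unfolding ultralimit_def by (rule quotientI[OF assms])

text \<open>The distance is a \<open>THE\<close> over all representatives of two classes. Changing
  representatives changes the distances by a null sequence, so one pair of representatives computes
  it.\<close>

lemma ultra_dist_class: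
  assumes U: "ultrafilter U" and M: "\<And>n. Metric_space (M n) (d n)" and x: "\<And>n. x n \<in> M n"
    and y: "y \<in> bounded_sequences M d x" and z: "z \<in> bounded_sequences M d x"
    and lim: "((\<lambda>n. d n (y n) (z n)) \<longlongrightarrow> r) U"
  shows "ultra_dist U M d x (ultra_rel U M d x `` {y}) (ultra_rel U M d x `` {z}) = r"
proof -
  let ?R = "ultra_rel U M d x" and ?S = "bounded_sequences M d x"
  have nb: "U \<noteq> bot" using U by (simp add: ultrafilter_def)
  have comm: "d n p q = d n q p" for n p q by (rule Metric_space.commute[OF M])
  have tri: "d n (u n) (w n) \<le> d n (u n) (v n) + d n (v n) (w n)"
    if "u \<in> ?S" "v \<in> ?S" "w \<in> ?S" for n u v w
    using Metric_space.triangle[OF M] that unfolding bounded_sequences_def by blast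
  have self: "p \<in> ?R `` {p}" if p: "p \<in> ?S" for p
  proof -
    have "d n (p n) (p n) = 0" for n
      using Metric_space.zero[OF M] p unfolding bounded_sequences_def by blast
    then show ?thesis using p unfolding ultra_rel_def by simp
  qed
  have all: "((\<lambda>n. d n (y' n) (z' n)) \<longlongrightarrow> r) U" if y': "y' \<in> ?R `` {y}" and z': "z' \<in> ?R `` {z}" for y' z'
  proof -
    have l: "y' \<in> ?S" "z' \<in> ?S" "((\<lambda>n. d n (y n) (y' n)) \<longlongrightarrow> 0) U" "((\<lambda>n. d n (z n) (z' n)) \<longlongrightarrow> 0) U"
      using y' z' unfolding ultra_rel_def by auto
    have "\<bar>d n (y' n) (z' n) - d n (y n) (z n)\<bar> \<le> d n (y n) (y' n) + d n (z n) (z' n)" for n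
      using tri[OF l(1) y l(2), of n] tri[OF y z l(2), of n] tri[OF y l(1) z, of n]
        tri[OF l(1) l(2) z, of n] comm[of n "z n" "z' n"] comm[of n "y n" "y' n"] by linarith
    then have "((\<lambda>n. d n (y' n) (z' n) - d n (y n) (z n)) \<longlongrightarrow> 0) U"
      by (intro Lim_null_comparison[OF _ tendsto_add_zero[OF l(3,4)]] always_eventually) simp
    from tendsto_add[OF this lim] show ?thesis by simp
  qed
  have "ultra_dist U M d x (?R `` {y}) (?R `` {z}) =
    (THE r. \<forall>y'\<in>?R `` {y}. \<forall>z'\<in>?R `` {z}. ((\<lambda>n. d n (y' n) (z' n)) \<longlongrightarrow> r) U)"
    unfolding ultra_dist_def using ultralimit_classI[OF y] ultralimit_classI[OF z] by simp
  also have "\<dots> = r"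
  proof (rule the_equality)
    show "\<forall>y'\<in>?R `` {y}. \<forall>z'\<in>?R `` {z}. ((\<lambda>n. d n (y' n) (z' n)) \<longlongrightarrow> r) U"
      using all by blast
    show "r' = r" if "\<forall>y'\<in>?R `` {y}. \<forall>z'\<in>?R `` {z}. ((\<lambda>n. d n (y' n) (z' n)) \<longlongrightarrow> r') U" for r'
      using that self[OF y] self[OF z] lim by (blast intro: tendsto_unique[OF nb])
  qed
  finally show ?thesis .
qed

lemma (in Metric_space) continuous_map_unit_speed:
  assumes \<gamma>: "\<And>t. t \<in> {0..1::real} \<Longrightarrow> \<gamma> t \<in> M"
    "\<And>s t. s \<in> {0..1} \<Longrightarrow> t \<in> {0..1} \<Longrightarrow> d (\<gamma> s) (\<gamma> t) = \<bar>s - t\<bar>"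
  shows "continuous_map (top_of_set {0..1}) mtopology \<gamma>"
  unfolding continuous_map_to_metric
proof (intro ballI allI impI)
  fix x and \<epsilon> :: real
  assume x: "x \<in> topspace (top_of_set {0..1::real})" and \<epsilon>: "\<epsilon> > 0"
  show "\<exists>U. openin (top_of_set {0..1}) U \<and> x \<in> U \<and> (\<forall>y\<in>U. \<gamma> y \<in> mball (\<gamma> x) \<epsilon>)"
  proof (intro exI conjI ballI)
    show "openin (top_of_set {0..1}) ({0..1} \<inter> ball x \<epsilon>)" by (simp add: openin_open_Int)
    show "x \<in> {0..1} \<inter> ball x \<epsilon>" using x \<epsilon> by simp
    show "\<gamma> y \<in> mball (\<gamma> x) \<epsilon>" if "y \<in> {0..1} \<inter> ball x \<epsilon>" for y
      using that x \<gamma> by (simp add: dist_real_def)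
  qed
qed

text \<open>In \<open>\<real>\<close> an arc between two points contains every other one, so an embedding would force the
  two geodesics to have the same image.\<close>

lemma (in Metric_space) two_geodesics_not_embeddable:
  assumes \<gamma>: "\<And>t. t \<in> {0..1::real} \<Longrightarrow> \<gamma> t \<in> M"
      "\<And>s t. s \<in> {0..1} \<Longrightarrow> t \<in> {0..1} \<Longrightarrow> d (\<gamma> s) (\<gamma> t) = \<bar>s - t\<bar>"
    and \<eta>: "\<And>t. t \<in> {0..1::real} \<Longrightarrow> \<eta> t \<in> M"
      "\<And>s t. s \<in> {0..1} \<Longrightarrow> t \<in> {0..1} \<Longrightarrow> d (\<eta> s) (\<eta> t) = \<bar>s - t\<bar>"
    and ends: "\<gamma> 0 = \<eta> 0" "\<gamma> 1 = \<eta> 1" and s: "s \<in> {0..1}" "\<gamma> s \<noteq> \<eta> s"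
  shows "\<not> embedding_map mtopology euclideanreal f"
proof
  assume f: "embedding_map mtopology euclideanreal f"
  have inj: "inj_on f M"
    using f homeomorphic_imp_injective_map unfolding embedding_map_def by fastforce
  have cont: "continuous_map mtopology euclideanreal f"
    using f homeomorphic_imp_continuous_map unfolding embedding_map_def
    by (blast intro: continuous_map_into_fulltopology)
  have c\<gamma>: "continuous_on {0..1} (f \<circ> \<gamma>)" and c\<eta>: "continuous_on {0..1} (f \<circ> \<eta>)"
    using continuous_map_compose[OF continuous_map_unit_speed[OF \<gamma>] cont]
      continuous_map_compose[OF continuous_map_unit_speed[OF \<eta>] cont] by auto
  have "inj_on (f \<circ> \<eta>) {0..1}"
  proof (rule inj_onI)
    fix a b assume ab: "a \<in> {0..1}" "b \<in> {0..1}" "(f \<circ> \<eta>) a = (f \<circ> \<eta>) b"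
    then have "\<eta> a = \<eta> b" using inj \<eta>(1) by (auto dest: inj_onD)
    then show "a = b" using \<eta>(2)[OF ab(1,2)] \<eta>(1)[OF ab(2)] by simp
  qed
  moreover have "0 < s" "s < 1" using s ends by (auto simp: less_le)
  ultimately have "f (\<eta> 0) < f (\<eta> s) \<and> f (\<eta> s) < f (\<eta> 1) \<or> f (\<eta> 1) < f (\<eta> s) \<and> f (\<eta> s) < f (\<eta> 0)"
    using continuous_inj_imp_mono[OF _ _ c\<eta>, of s] by simp
  then have "\<exists>t. 0 \<le> t \<and> t \<le> 1 \<and> (f \<circ> \<gamma>) t = f (\<eta> s)"
  proof
    assume "f (\<eta> 0) < f (\<eta> s) \<and> f (\<eta> s) < f (\<eta> 1)"
    then show ?thesis using c\<gamma> ends by (intro IVT') auto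
  next
    assume "f (\<eta> 1) < f (\<eta> s) \<and> f (\<eta> s) < f (\<eta> 0)"
    then show ?thesis using c\<gamma> ends by (intro IVT2') auto
  qed
  then obtain t where t: "t \<in> {0..1}" "f (\<gamma> t) = f (\<eta> s)" by auto
  then have eq: "\<gamma> t = \<eta> s" using inj \<gamma>(1)[OF t(1)] \<eta>(1)[OF s(1)] by (auto dest: inj_onD)
  \<comment> \<open>The parameter is the distance from the common starting point, so curves meeting
    at a point meet there with equal parameters.\<close>
  have "d (\<gamma> 0) (\<gamma> t) = t" "d (\<eta> 0) (\<eta> s) = s" using \<gamma>(2)[of 0 t] \<eta>(2)[of 0 s] t(1) s(1) by auto
  then have "t = s" using eq ends by simp
  then show False using eq s(2) by simp
qed

text \<open>The parameter \<sigma> of separation may vary with \<open>n\<close>. It converges along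
  \<open>U\<close> to some \<open>s\<close> by compactness, and both curves have unit speed, so the
  separation survives at \<open>s\<close> in the limit.\<close>

lemma ultralimit_not_embeddable:
  assumes U: "ultrafilter U" and M: "\<And>n. Metric_space (M n) (d n)" and x: "\<And>n. x n \<in> M n"
    and I: "eventually (\<lambda>n. n \<in> I) U"
    and a: "\<And>n t. n \<in> I \<Longrightarrow> t \<in> {0..1} \<Longrightarrow> a n t \<in> M n \<and> d n (a n t) (x n) \<le> B"
      "\<And>n s t. n \<in> I \<Longrightarrow> s \<in> {0..1} \<Longrightarrow> t \<in> {0..1} \<Longrightarrow> d n (a n s) (a n t) = \<bar>s - t\<bar>"
    and b: "\<And>n t. n \<in> I \<Longrightarrow> t \<in> {0..1} \<Longrightarrow> b n t \<in> M n \<and> d n (b n t) (x n) \<le> B"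
      "\<And>n s t. n \<in> I \<Longrightarrow> s \<in> {0..1} \<Longrightarrow> t \<in> {0..1} \<Longrightarrow> d n (b n s) (b n t) = \<bar>s - t\<bar>"
    and ends: "\<And>n. n \<in> I \<Longrightarrow> a n 0 = b n 0 \<and> a n 1 = b n 1"
    and sep: "\<kappa> > 0"
      "\<And>n. n \<in> I \<Longrightarrow> \<sigma> n \<in> {0..1::real} \<and> \<kappa> \<le> d n (a n (\<sigma> n)) (b n (\<sigma> n))"
  shows "\<not> embedding_map (Metric_space.mtopology (ultralimit U M d x) (ultra_dist U M d x))
    euclideanreal f"
proof -
  let ?S = "bounded_sequences M d x"
  \<comment> \<open>Bounded sequences are required at all indices, while the curves exist only on
    \<open>I\<close>. The base point fills the other indices, which \<open>U\<close> does not see;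
    being at distance 0, it also explains the bound \<open>max B 0\<close>.\<close>
  define lift where "lift c t n = (if n \<in> I then c n t else x n)" for c :: "'a \<Rightarrow> real \<Rightarrow> 'b" and t n
  define cl where "cl c t = ultra_rel U M d x `` {lift c t}" for c t
  have nb: "U \<noteq> bot" using U by (simp add: ultrafilter_def)
  interpret ul: Metric_space "ultralimit U M d x" "ultra_dist U M d x"
    by (rule Metric_space_ultralimit[OF U M x])
  have zero: "d n (x n) (x n) = 0" for n using Metric_space.zero[OF M x x] by blast
  have S: "lift c t \<in> ?S"
    if "\<And>n t. n \<in> I \<Longrightarrow> t \<in> {0..1} \<Longrightarrow> c n t \<in> M n \<and> d n (c n t) (x n) \<le> B" "t \<in> {0..1}" for c t
    unfolding bounded_sequences_def
  proof (intro CollectI conjI exI allI)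
    show "lift c t n \<in> M n" for n using that x unfolding lift_def by simp
    show "d n (lift c t n) (x n) \<le> max B 0" for n
      using that zero unfolding lift_def by (simp add: le_max_iff_disj)
  qed
  have Sa: "lift a t \<in> ?S" and Sb: "lift b t \<in> ?S" if "t \<in> {0..1}" for t
    using S[of a t, OF a(1) that] S[of b t, OF b(1) that] by blast+
  have iso: "ultra_dist U M d x (cl c s) (cl c t) = \<bar>s - t\<bar>"
    if "\<And>t. t \<in> {0..1} \<Longrightarrow> lift c t \<in> ?S" "s \<in> {0..1}" "t \<in> {0..1}"
      "\<And>n s t. n \<in> I \<Longrightarrow> s \<in> {0..1} \<Longrightarrow> t \<in> {0..1} \<Longrightarrow> d n (c n s) (c n t) = \<bar>s - t\<bar>" for c s t
    unfolding cl_def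
  proof (rule ultra_dist_class[OF U M x that(1)[OF that(2)] that(1)[OF that(3)]])
    have "eventually (\<lambda>n. d n (lift c s n) (lift c t n) = \<bar>s - t\<bar>) U"
      using I by eventually_elim (simp add: lift_def that(4)[OF _ that(2,3)])
    then show "((\<lambda>n. d n (lift c s n) (lift c t n)) \<longlongrightarrow> \<bar>s - t\<bar>) U"
      by (rule tendsto_eventually)
  qed
  have eq: "cl a t = cl b t" if "t = 0 \<or> t = 1" for t
  proof -
    have "lift a t = lift b t" using ends that unfolding lift_def by auto
    then show ?thesis unfolding cl_def by simp
  qed
  define \<tau> where "\<tau> n = (if n \<in> I then \<sigma> n else 0)" for n
  have \<tau>01: "\<tau> n \<in> {0..1}" for n using sep(2) unfolding \<tau>_def by simp
  then obtain s where s: "(\<tau> \<longlongrightarrow> s) U" using ultrafilter_bounded_convergent[OF U] by blast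
  have s01: "s \<in> {0..1}"
    using tendsto_lowerbound[OF s _ nb, of 0] tendsto_upperbound[OF s _ nb, of 1] \<tau>01 by simp
  have bd: "d n (lift a s n) (lift b s n) \<in> {0..2 * max B 0}" for n
  proof -
    have mem: "lift a s n \<in> M n" "lift b s n \<in> M n"
      using Sa[OF s01] Sb[OF s01] unfolding bounded_sequences_def by auto
    have "d n (lift a s n) (x n) \<le> max B 0" "d n (lift b s n) (x n) \<le> max B 0"
      using a(1)[OF _ s01, of n] b(1)[OF _ s01, of n] zero[of n] unfolding lift_def by auto
    then show ?thesis
      using Metric_space.triangle[OF M mem(1) x mem(2)] Metric_space.nonneg[OF M]
        Metric_space.commute[OF M, of n "lift b s n" "x n"] by fastforce
  qed
  then obtain l where l: "((\<lambda>n. d n (lift a s n) (lift b s n)) \<longlongrightarrow> l) U"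
    using ultrafilter_bounded_convergent[OF U, of "\<lambda>n. d n (lift a s n) (lift b s n)"] by blast
  \<comment> \<open>Moving the parameter from \<open>\<tau> n\<close> to \<open>s\<close> costs at
    most their difference on each of the two curves.\<close>
  have "((\<lambda>n. \<kappa> - 2 * \<bar>\<tau> n - s\<bar>) \<longlongrightarrow> \<kappa> - 2 * \<bar>s - s\<bar>) U" by (intro tendsto_intros s)
  moreover have "eventually (\<lambda>n. \<kappa> - 2 * \<bar>\<tau> n - s\<bar> \<le> d n (lift a s n) (lift b s n)) U"
    using I
  proof eventually_elim
    case (elim n)
    have t: "\<tau> n = \<sigma> n" "\<sigma> n \<in> {0..1}" "\<kappa> \<le> d n (a n (\<sigma> n)) (b n (\<sigma> n))"
      using sep(2)[OF elim] elim unfolding \<tau>_def by auto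
    have mem: "a n s \<in> M n" "b n s \<in> M n" "a n (\<sigma> n) \<in> M n" "b n (\<sigma> n) \<in> M n"
      using a(1)[OF elim] b(1)[OF elim] s01 t(2) by blast+
    have "d n (a n (\<sigma> n)) (b n (\<sigma> n)) \<le> d n (a n (\<sigma> n)) (a n s) + d n (a n s) (b n (\<sigma> n))"
      "d n (a n s) (b n (\<sigma> n)) \<le> d n (a n s) (b n s) + d n (b n s) (b n (\<sigma> n))"
      using Metric_space.triangle[OF M] mem by blast+
    moreover have "d n (a n (\<sigma> n)) (a n s) = \<bar>\<tau> n - s\<bar>" "d n (b n s) (b n (\<sigma> n)) = \<bar>\<tau> n - s\<bar>"
      using a(2)[OF elim t(2) s01] b(2)[OF elim s01 t(2)] t(1) by (simp_all add: abs_minus_commute)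
    moreover have "lift a s n = a n s" "lift b s n = b n s" using elim unfolding lift_def by simp_all
    ultimately show ?case using t(3) by simp
  qed
  ultimately have "\<kappa> - 2 * \<bar>s - s\<bar> \<le> l" by (rule tendsto_le[OF nb l])
  then have "l > 0" using sep(1) by simp
  moreover have "ultra_dist U M d x (cl a s) (cl b s) = l"
    unfolding cl_def by (rule ultra_dist_class[OF U M x Sa[OF s01] Sb[OF s01] l])
  moreover have in_ul: "cl a t \<in> ultralimit U M d x" "cl b t \<in> ultralimit U M d x" if "t \<in> {0..1}" for t
    unfolding cl_def by (intro ultralimit_classI Sa Sb that)+
  ultimately have ne: "cl a s \<noteq> cl b s" using ul.zero[OF in_ul(1)[OF s01] in_ul(2)[OF s01]] by auto
  show ?thesis
  proof (rule ul.two_geodesics_not_embeddable[where \<gamma> = "cl a" and \<eta> = "cl b" and s = s])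
    show "ultra_dist U M d x (cl a s) (cl a t) = \<bar>s - t\<bar>" if "s \<in> {0..1}" "t \<in> {0..1}" for s t
      by (rule iso[OF Sa that a(2)])
    show "ultra_dist U M d x (cl b s) (cl b t) = \<bar>s - t\<bar>" if "s \<in> {0..1}" "t \<in> {0..1}" for s t
      by (rule iso[OF Sb that b(2)])
  qed (use in_ul eq s01 ne in simp_all)
qed

section \<open>Measure of the circle edges\<close>

lemma directed_path_from_to_Cons:
  "directed_path_from_to G u v (e # P) \<longleftrightarrow> e \<in> edges G \<and> src G e = u \<and>
     (if P = [] then snk G e = v else directed_path_from_to G (snk G e) v P)"
proof (cases P)
  case (Cons f R)
  have "(\<forall>k. Suc k < length (e # P) \<longrightarrow> snk G ((e # P) ! k) = src G ((e # P) ! Suc k)) \<longleftrightarrow>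
    snk G e = src G f \<and> (\<forall>k. Suc k < length P \<longrightarrow> snk G (P ! k) = src G (P ! Suc k))"
    (is "(\<forall>k. ?A k) \<longleftrightarrow> ?B \<and> (\<forall>k. ?C k)")
  proof
    assume A: "\<forall>k. ?A k"
    have "?C k" for k using A[rule_format, of "Suc k"] by simp
    then show "?B \<and> (\<forall>k. ?C k)" using A[rule_format, of 0] Cons by simp
  next
    assume B: "?B \<and> (\<forall>k. ?C k)"
    show "\<forall>k. ?A k"
    proof
      fix k show "?A k" using B Cons by (cases k) simp_all
    qed
  qed
  then show ?thesis
    using Cons unfolding directed_path_from_to_def directed_path_def by auto
qed (auto simp: directed_path_from_to_def directed_path_def)

lemma directed_path_from_to_append:
  assumes "directed_path_from_to G u w P" "directed_path_from_to G w v Q"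
  shows "directed_path_from_to G u v (P @ Q)"
  using assms
proof (induction P arbitrary: u)
  case Nil
  then show ?case by (simp add: directed_path_from_to_def directed_path_def)
next
  case (Cons e P)
  have "Q \<noteq> []" using Cons.prems(2) by (auto simp: directed_path_from_to_def directed_path_def)
  then show ?case
    using Cons by (cases "P = []") (simp_all add: directed_path_from_to_Cons)
qed

lemma directed_path_from_to_concat:
  assumes "directed_path_from_to G u v P"
    and "\<And>e. e \<in> set P \<Longrightarrow> directed_path_from_to G' (src G e) (snk G e) (Q e)"
  shows "directed_path_from_to G' u v (concat (map Q P))"
  using assms
proof (induction P arbitrary: u)
  case Nil
  then show ?case by (simp add: directed_path_from_to_def directed_path_def)
next
  case (Cons e P)
  have e: "directed_path_from_to G' u (snk G e) (Q e)"
    using Cons.prems(2)[of e] Cons.prems(1) by (simp add: directed_path_from_to_Cons)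
  show ?case
  proof (cases "P = []")
    case True
    then show ?thesis using e Cons.prems(1) by (simp add: directed_path_from_to_Cons)
  next
    case False
    then have "directed_path_from_to G' (snk G e) v (concat (map Q P))"
      using Cons.prems(1) by (intro Cons.IH Cons.prems(2)) (simp_all add: directed_path_from_to_Cons)
    from directed_path_from_to_append[OF e this] show ?thesis by simp
  qed
qed

text \<open>Meant for a \<open>g\<close> that selects one of the two sides over each edge; both
  sides have the same source and sink.\<close>

lemma directed_path_from_to_map:
  assumes "directed_path_from_to G u v P"
    and "\<And>e. e \<in> edges G \<Longrightarrow> g e \<in> edges G' \<and> src G' (g e) = src G e \<and> snk G' (g e) = snk G e"
  shows "directed_path_from_to G' u v (map g P)"
  using assms(1)
proof (induction P arbitrary: u)
  case Nil
  then show ?case by (simp add: directed_path_from_to_def directed_path_def)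
next
  case (Cons e P)
  then show ?case using assms(2) by (cases "P = []") (simp_all add: directed_path_from_to_Cons)
qed

text \<open>(A6) counts each edge of a path once, whereas the cost of a path sums over the list and
  could repeat an edge.\<close>

lemma sum_set_le_sum_list:
  fixes F :: "'b \<Rightarrow> real"
  assumes "\<And>x. x \<in> set P \<Longrightarrow> 0 \<le> F x"
  shows "sum F (set P) \<le> sum_list (map F P)"
  using assms by (induction P) (auto simp: sum.insert_if add_increasing)

text \<open>The other edges meet \<open>A\<close> in finitely many points and contribute nothing, so
  a single coordinate computes the length.\<close>

lemma graph_length_subset_edge:
  assumes G: "directed_metric_graph G" and e: "e \<in> edges G" and A: "A \<subseteq> e"
  shows "graph_length G A = emeasure lborel (dist (src G e) ` A)"
proof -
  have 0: "emeasure lborel (dist (src G f) ` (A \<inter> f)) = 0" if "f \<in> edges G - {e}" for f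
  proof -
    have "finite (A \<inter> f)"
      using graph_edges_Int_finite[OF G e, of f] that A by (auto intro: finite_subset[of _ "e \<inter> f"])
    then show ?thesis by (intro emeasure_lborel_countable countable_finite) blast
  qed
  have "graph_length G A = (\<Sum>f\<in>{e}. emeasure lborel (dist (src G f) ` (A \<inter> f)))"
    unfolding graph_length_def using graph_finite[OF G] e 0
    by (intro sum.mono_neutral_right) auto
  then show ?thesis using A by (simp add: inf.absorb1)
qed

lemma graph_length_finite_eq_0: "finite A \<Longrightarrow> graph_length G A = 0"
  unfolding graph_length_def
  by (intro sum.neutral ballI emeasure_lborel_countable countable_finite) auto

lemma graph_length_subedge:
  assumes G: "directed_metric_graph G" and sub: "directed_subdivision G' G" and e: "subedge G' G e' e"
  shows "graph_length G e' = ennreal (edge_length G' e')"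
proof -
  have mem: "e \<in> edges G" "e' \<in> edges G'" "e' \<subseteq> e" using e unfolding subedge_def by auto
  have "graph_length G e' = emeasure lborel (dist (src G e) ` e')"
    by (rule graph_length_subset_edge[OF G mem(1,3)])
  also have "\<dots> = ennreal (edge_length G' e')"
    unfolding subsegment_image[OF graph_edge_segment[OF G mem(1)]
      graph_edge_segment[OF subdivision_graph[OF sub] mem(2)] mem(3) subdivision_oriented[OF G sub e]]
      edge_length_def by simp
  finally show ?thesis .
qed

lemma graph_length_edge:
  assumes G: "directed_metric_graph G" and e: "e \<in> edges G"
  shows "graph_length G e = ennreal (edge_length G e)"
  using graph_length_subset_edge[OF G e order_refl]
  unfolding segment_image[OF graph_edge_segment[OF G e]] edge_length_def by simp

section \<open>The two sides of a circle\<close>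

context thick_inverse_system
begin

lemma graph': "directed_metric_graph (X' i)"
  by (rule subdivision_graph[OF A2_subdivision])

lemma points_X': "points (X' i) = points (X i)"
  using A2_subdivision unfolding directed_subdivision_def by blast

lemma points_mono: "i \<le> j \<Longrightarrow> points (X i) \<subseteq> points (X j)"
  by (rule lift_Suc_mono_le[of "\<lambda>i. points (X i)"]) (rule increasing)

lemma opp_edge:
  assumes "e' \<in> edges (X' i)"
  shows "opp i e' \<in> edges (X (Suc i))" "src (X (Suc i)) (opp i e') = src (X' i) e'"
    "snk (X (Suc i)) (opp i e') = snk (X' i) e'"
  using A2_edges[OF assms] A2_circle[OF assms] by auto

lemma same_edge:
  assumes "e' \<in> edges (X' i)"
  shows "e' \<in> edges (X (Suc i))" "src (X (Suc i)) e' = src (X' i) e'"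
    "snk (X (Suc i)) e' = snk (X' i) e'"
  using A2_edges[OF assms] by auto

lemma edge_length_lift:
  assumes "e' \<in> edges (X' i)"
  shows "edge_length (X (Suc i)) e' = edge_length (X' i) e'"
    "edge_length (X (Suc i)) (opp i e') = edge_length (X' i) e'"
  unfolding edge_length_def using opp_edge[OF assms] same_edge[OF assms] by simp_all

lemma segment':
  assumes "e' \<in> edges (X' i)"
  shows "is_segment e' (src (X' i) e') (snk (X' i) e')"
    "is_segment (opp i e') (src (X' i) e') (snk (X' i) e')"
  using graph_edge_segment[OF graph' assms] graph_edge_segment[OF graph opp_edge(1)[OF assms]]
    opp_edge[OF assms] by simp_all

lemma proj_image: "e' \<in> edges (X' i) \<Longrightarrow> \<pi> i ` e' = e'"
  using A4_id by auto

text \<open>The projection fixes every edge of \<open>X' i\<close> but sends the opposite edge onto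
  \<open>e'\<close>; an opposite edge in \<open>X' i\<close> would therefore equal
  \<open>e'\<close>.\<close>

lemma opp_notin_edges:
  assumes "e' \<in> edges (X' i)" "opp i e' \<noteq> e'"
  shows "opp i e' \<notin> edges (X' i)"
  using proj_image[of "opp i e'" i] A4_isometry[OF assms(1)] assms(2) by auto

lemma inj_on_opp: "inj_on (opp i) (edges (X' i))"
  using A4_isometry by (metis inj_onI)

text \<open>The projection is isometric on the opposite edge and fixes the common source, so it
  preserves the coordinate. Opposite points thus have equal coordinates on the two sides.\<close>

lemma proj_opp:
  assumes e': "e' \<in> edges (X' i)" and q: "q \<in> opp i e'"
  shows "\<pi> i q \<in> e'" "dist (src (X' i) e') (\<pi> i q) = dist (src (X' i) e') q"
proof -
  show "\<pi> i q \<in> e'" using A4_isometry[OF e'] q by blast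
  have "src (X' i) e' \<in> e'" "src (X' i) e' \<in> opp i e'"
    using segment_ends[OF segment'(1)[OF e']] segment_ends[OF segment'(2)[OF e']] by auto
  then show "dist (src (X' i) e') (\<pi> i q) = dist (src (X' i) e') q"
    using A4_isometry[OF e'] A4_id[OF e'] q by metis
qed

lemma opp_point:
  assumes e': "e' \<in> edges (X' i)" and p: "p \<in> e'"
  shows "opp_point \<pi> opp i e' p \<in> opp i e'"
    "dist (src (X' i) e') (opp_point \<pi> opp i e' p) = dist (src (X' i) e') p"
proof -
  have "\<exists>!q. q \<in> opp i e' \<and> \<pi> i q = p"
  proof (rule ex_ex1I)
    have "p \<in> \<pi> i ` opp i e'" using A4_isometry[OF e'] p by simp
    then show "\<exists>q. q \<in> opp i e' \<and> \<pi> i q = p" by blast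
    show "q = r" if "q \<in> opp i e' \<and> \<pi> i q = p" "r \<in> opp i e' \<and> \<pi> i r = p" for q r
    proof -
      have "dist q r = dist (\<pi> i q) (\<pi> i r)" using A4_isometry[OF e'] that by metis
      then show ?thesis using that by simp
    qed
  qed
  from theI'[OF this] have *: "opp_point \<pi> opp i e' p \<in> opp i e'" "\<pi> i (opp_point \<pi> opp i e' p) = p"
    unfolding opp_point_def by auto
  show "opp_point \<pi> opp i e' p \<in> opp i e'" by (rule *)
  show "dist (src (X' i) e') (opp_point \<pi> opp i e' p) = dist (src (X' i) e') p"
    using proj_opp(2)[OF e' *(1)] *(2) by simp
qed

text \<open>A point and its projection lie over the same \<open>e'\<close>, each at distance at most
  the length of \<open>e'\<close> from the common source.\<close>

lemma proj_displacement:
  assumes p: "p \<in> points (X (Suc i))"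
  obtains e' where "e' \<in> edges (X' i)" "dist p (\<pi> i p) \<le> 2 * edge_length (X' i) e'"
proof -
  have "\<pi> i p \<in> points (X' i)" using maps_to p unfolding points_X' by blast
  then obtain e' where e': "e' \<in> edges (X' i)" "\<pi> i p \<in> e'" unfolding points_def by blast
  have "p \<in> e' \<union> opp i e'" using A2_preimage[OF e'(1)] p e'(2) by blast
  moreover have "dist p (\<pi> i p) \<le> 2 * edge_length (X' i) e'" if "p \<in> e'"
    using A4_id[OF e'(1) that] edge_length_pos[OF graph' e'(1)] by simp
  moreover have "dist p (\<pi> i p) \<le> 2 * edge_length (X' i) e'" if "p \<in> opp i e'"
    using segment_dist_le[OF segment'(1)[OF e'(1)] e'(2)] segment_dist_le[OF segment'(2)[OF e'(1)] that]
      dist_triangle3[of p "\<pi> i p" "src (X' i) e'"] unfolding edge_length_def by linarith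
  ultimately show thesis using that e'(1) by blast
qed

end

section \<open>Measures of edges and paths of at most average cost\<close>

locale measured_thick_system = thick_inverse_system X X' \<pi> opp v0 v1
  for X X' :: "nat \<Rightarrow> 'a::metric_space mgraph" and \<pi> opp v0 v1 +
  fixes \<mu> :: "nat \<Rightarrow> 'a measure"
  assumes measures: "system_measures X X' opp \<mu>"
begin

lemma prob_space_\<mu>: "prob_space (\<mu> i)"
  and sets_\<mu>: "sets (\<mu> i) = sets (restrict_space borel (points (X i)))"
  using measures[unfolded system_measures_def, THEN conjunct1] by simp_all

lemma compact_in_sets:
  assumes "compact A" "A \<subseteq> points (X i)"
  shows "A \<in> sets (\<mu> i)"
proof -
  have "points (X i) \<in> sets borel"
    using graph_compact[OF graph] compact_imp_closed by (metis borel_closed)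
  then show ?thesis
    unfolding sets_\<mu> using assms compact_imp_closed borel_closed
    by (auto simp: sets_restrict_space_iff)
qed

lemma edge_in_sets: "e \<in> edges (X i) \<Longrightarrow> e \<in> sets (\<mu> i)"
  by (intro compact_in_sets segment_compact[OF graph_edge_segment[OF graph]] edge_subset_points)

lemma edge'_in_sets: "e' \<in> edges (X' i) \<Longrightarrow> e' \<in> sets (\<mu> i)"
  using points_X' edge_subset_points
  by (intro compact_in_sets segment_compact[OF graph_edge_segment[OF graph']]) blast+

lemma uniform_on_edge:
  assumes "e \<in> edges (X i)"
  obtains c where "\<And>A. A \<in> sets (\<mu> i) \<Longrightarrow> A \<subseteq> e \<Longrightarrow> emeasure (\<mu> i) A = c * graph_length (X i) A"
proof (cases i)
  case 0
  show thesis
    by (rule that[of 1]) (use measures 0 in \<open>simp add: system_measures_def\<close>)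
next
  case (Suc j)
  have "\<exists>c. \<forall>A\<in>sets (\<mu> i). A \<subseteq> e \<longrightarrow> emeasure (\<mu> i) A = c * graph_length (X i) A"
    using measures[unfolded system_measures_def, THEN conjunct2, THEN conjunct2, THEN conjunct1] assms
    unfolding Suc by simp
  then show thesis using that by blast
qed

lemma finite_null_sets:
  assumes "finite A" "A \<subseteq> points (X i)"
  shows "A \<in> null_sets (\<mu> i)"
  using assms
proof (induction A)
  case (insert v A)
  obtain e where e: "e \<in> edges (X i)" "v \<in> e" using insert.prems unfolding points_def by blast
  obtain c where "\<And>A. A \<in> sets (\<mu> i) \<Longrightarrow> A \<subseteq> e \<Longrightarrow> emeasure (\<mu> i) A = c * graph_length (X i) A"
    using uniform_on_edge[OF e(1)] by blast
  moreover have v: "{v} \<in> sets (\<mu> i)" using insert.prems by (intro compact_in_sets) auto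
  ultimately have "emeasure (\<mu> i) {v} = 0" using e(2) graph_length_finite_eq_0[of "{v}"] by simp
  then have "{v} \<in> null_sets (\<mu> i)" using v by blast
  then have "{v} \<union> A \<in> null_sets (\<mu> i)" using insert by (intro null_sets.Un) auto
  then show ?case by simp
qed simp

lemma subedge_measure:
  assumes e: "subedge (X' i) (X i) e' e"
  shows "measure (\<mu> i) e' / edge_length (X' i) e' = measure (\<mu> i) e / edge_length (X i) e"
proof -
  have mem: "e \<in> edges (X i)" "e' \<in> edges (X' i)" "e' \<subseteq> e" using e unfolding subedge_def by auto
  note pos = edge_length_pos[OF graph mem(1)] edge_length_pos[OF graph' mem(2)]
  interpret prob_space "\<mu> i" by (rule prob_space_\<mu>)
  obtain c where c: "\<And>A. A \<in> sets (\<mu> i) \<Longrightarrow> A \<subseteq> e \<Longrightarrow> emeasure (\<mu> i) A = c * graph_length (X i) A"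
    using uniform_on_edge[OF mem(1)] by blast
  have e1: "emeasure (\<mu> i) e = c * ennreal (edge_length (X i) e)"
    using c[OF edge_in_sets[OF mem(1)]] graph_length_edge[OF graph mem(1)] by simp
  have e2: "emeasure (\<mu> i) e' = c * ennreal (edge_length (X' i) e')"
    using c[OF edge'_in_sets[OF mem(2)] mem(3)] graph_length_subedge[OF graph A2_subdivision e] by simp
  \<comment> \<open>The density is an extended number; an infinite one would give the edge infinite
    mass, because its length is positive.\<close>
  have "c \<noteq> \<top>"
  proof
    assume "c = \<top>"
    then have "emeasure (\<mu> i) e = \<top>" using e1 pos by (simp add: ennreal_top_mult)
    then show False by simp
  qed
  then obtain r where r: "c = ennreal r" "0 \<le> r" by (metis ennreal_cases)
  have "measure (\<mu> i) e = r * edge_length (X i) e" "measure (\<mu> i) e' = r * edge_length (X' i) e'"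
    using e1 e2 r pos by (simp_all add: measure_def enn2real_mult)
  then show ?thesis using pos by simp
qed

text \<open>Instead of averaging over random paths, it is enough to find one path whose cost is at most the
  average cost.\<close>

definition dominated :: "nat \<Rightarrow> 'a mgraph \<Rightarrow> bool" where
  "dominated i G \<longleftrightarrow> (\<forall>F. (\<forall>e\<in>edges G. 0 \<le> F e) \<longrightarrow>
     (\<exists>P. directed_path_from_to G v0 v1 P \<and>
        sum_list (map F P) \<le> (\<Sum>e\<in>edges G. F e * (measure (\<mu> i) e / edge_length G e))))"

lemma dominated_0: "dominated 0 (X 0)"
proof -
  obtain e where e: "edges (X 0) = {e}" "src (X 0) e = v0" "snk (X 0) e = v1" "edge_length (X 0) e = 1"
    using A1(3) by blast
  have "emeasure (\<mu> 0) e = graph_length (X 0) e"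
    using measures[unfolded system_measures_def, THEN conjunct2, THEN conjunct1] edge_in_sets[of e 0] e(1)
    by simp
  then have "measure (\<mu> 0) e = 1" using graph_length_edge[OF graph, of e 0] e by (simp add: measure_def)
  then show ?thesis unfolding dominated_def
    using e by (intro allI impI exI[of _ "[e]"]) (simp add: directed_path_from_to_Cons)
qed

text \<open>Charging each edge the total cost of its subedges preserves the average, since subedges
  inherit the density. Replacing each edge of the path by its chain of distinct subedges costs no
  more than that charge.\<close>

lemma dominated_subdivision:
  assumes dom: "dominated i (X i)"
  shows "dominated i (X' i)"
  unfolding dominated_def
proof (intro allI impI)
  fix F :: "'a set \<Rightarrow> real" assume F: "\<forall>e'\<in>edges (X' i). 0 \<le> F e'"
  define S where "S e = {e'. subedge (X' i) (X i) e' e}" for e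
  have fin: "finite (S e)" for e
    using graph_finite[OF graph'] unfolding S_def subedge_def by (auto intro: finite_subset)
  have F0: "0 \<le> F e'" if "e' \<in> S e" for e e' using F that unfolding S_def subedge_def by blast
  have "\<forall>e\<in>edges (X i). 0 \<le> sum F (S e)" using F0 by (auto intro: sum_nonneg)
  then obtain P where P: "directed_path_from_to (X i) v0 v1 P"
    "sum_list (map (\<lambda>e. sum F (S e)) P) \<le>
       (\<Sum>e\<in>edges (X i). sum F (S e) * (measure (\<mu> i) e / edge_length (X i) e))"
    using dom[unfolded dominated_def, rule_format, of "\<lambda>e. sum F (S e)"] by auto
  have "\<exists>Q. directed_path_from_to (X' i) (src (X i) e) (snk (X i) e) Q \<and> distinct Q \<and> set Q \<subseteq> S e"
    if "e \<in> edges (X i)" for e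
    by (rule subdivision_chain[OF graph A2_subdivision that]) (auto simp: S_def)
  then obtain Q where Q: "\<And>e. e \<in> edges (X i) \<Longrightarrow>
      directed_path_from_to (X' i) (src (X i) e) (snk (X i) e) (Q e) \<and> distinct (Q e) \<and> set (Q e) \<subseteq> S e"
    by metis
  have Pe: "set P \<subseteq> edges (X i)" using P(1) unfolding directed_path_from_to_def directed_path_def by blast
  have "sum_list (map F (Q e)) \<le> sum F (S e)" if "e \<in> set P" for e
  proof -
    have "sum_list (map F (Q e)) = sum F (set (Q e))"
      using Q Pe that by (intro sum_list_distinct_conv_sum_set) auto
    also have "\<dots> \<le> sum F (S e)" using Q Pe that F0 fin by (intro sum_mono2) auto
    finally show ?thesis .
  qed
  then have "sum_list (map F (concat (map Q P))) \<le> sum_list (map (\<lambda>e. sum F (S e)) P)"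
    by (induction P) (auto intro: add_mono)
  also note P(2)
  also have "(\<Sum>e\<in>edges (X i). sum F (S e) * (measure (\<mu> i) e / edge_length (X i) e)) =
    (\<Sum>e\<in>edges (X i). \<Sum>e'\<in>S e. F e' * (measure (\<mu> i) e' / edge_length (X' i) e'))"
    using subedge_measure unfolding sum_distrib_right S_def by (intro sum.cong refl) auto
  \<comment> \<open>Each subedge has a unique parent, so the double sum runs through every edge of
    \<open>X' i\<close> once.\<close>
  also have "\<dots> = (\<Sum>e'\<in>(\<Union>e\<in>edges (X i). S e). F e' * (measure (\<mu> i) e' / edge_length (X' i) e'))"
    using graph_finite[OF graph] fin subdivision_parent_unique[OF graph graph'] unfolding S_def
    by (intro sum.UNION_disjoint[symmetric]) blast+
  also have "(\<Union>e\<in>edges (X i). S e) = edges (X' i)"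
    using A2_subdivision[of i] unfolding S_def directed_subdivision_def subedge_def by blast
  finally show "\<exists>P. directed_path_from_to (X' i) v0 v1 P \<and>
      sum_list (map F P) \<le> (\<Sum>e\<in>edges (X' i). F e * (measure (\<mu> i) e / edge_length (X' i) e))"
    using directed_path_from_to_concat[OF P(1), of "X' i" Q] Q Pe by blast
qed

text \<open>The measure splits evenly over a circle, so the cheaper half costs at most the average.\<close>

lemma dominated_Suc:
  assumes dom: "dominated i (X' i)"
  shows "dominated (Suc i) (X (Suc i))"
  unfolding dominated_def
proof (intro allI impI)
  fix F :: "'a set \<Rightarrow> real" assume F: "\<forall>e\<in>edges (X (Suc i)). 0 \<le> F e"
  define g where "g e' = (if F (opp i e') < F e' then opp i e' else e')" for e'
  define m where "m e = F e * (measure (\<mu> (Suc i)) e / edge_length (X (Suc i)) e)" for e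
  define C where "C = {e' \<in> edges (X' i). opp i e' \<noteq> e'}"
  have "\<forall>e'\<in>edges (X' i). 0 \<le> F (g e')" using F opp_edge(1) same_edge(1) unfolding g_def by simp
  then obtain P where P: "directed_path_from_to (X' i) v0 v1 P"
    "sum_list (map (\<lambda>e'. F (g e')) P) \<le>
       (\<Sum>e'\<in>edges (X' i). F (g e') * (measure (\<mu> i) e' / edge_length (X' i) e'))"
    using dom[unfolded dominated_def, rule_format, of "\<lambda>e'. F (g e')"] by auto
  have fin: "finite (edges (X' i))" "finite C" using graph_finite[OF graph'] unfolding C_def by auto
  have "F (g e') * (measure (\<mu> i) e' / edge_length (X' i) e') \<le> m e' + (if e' \<in> C then m (opp i e') else 0)"
    if e': "e' \<in> edges (X' i)" for e'
  proof (cases "e' \<in> C")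
    case True
    then have half: "measure (\<mu> (Suc i)) e' = measure (\<mu> i) e' / 2"
      "measure (\<mu> (Suc i)) (opp i e') = measure (\<mu> i) e' / 2"
      using measures e' unfolding system_measures_def C_def by (auto split: if_splits)
    define t where "t = measure (\<mu> i) e' / edge_length (X' i) e'"
    have "0 \<le> t" using edge_length_pos[OF graph' e'] unfolding t_def by simp
    moreover have "F (g e') \<le> (F e' + F (opp i e')) / 2" unfolding g_def by simp
    ultimately have "F (g e') * t \<le> (F e' + F (opp i e')) / 2 * t" by (rule mult_right_mono[rotated])
    also have "\<dots> = m e' + m (opp i e')"
      unfolding m_def t_def half edge_length_lift[OF e'] by (simp add: add_divide_distrib distrib_right)
    finally show ?thesis using True unfolding t_def by simp
  next
    case False
    then have eq: "opp i e' = e'" using e' unfolding C_def by blast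
    then have "measure (\<mu> (Suc i)) e' = measure (\<mu> i) e'"
      using measures e' unfolding system_measures_def by (auto split: if_splits)
    then show ?thesis using False eq unfolding m_def g_def edge_length_lift[OF e'] by simp
  qed
  then have "(\<Sum>e'\<in>edges (X' i). F (g e') * (measure (\<mu> i) e' / edge_length (X' i) e'))
      \<le> (\<Sum>e'\<in>edges (X' i). m e' + (if e' \<in> C then m (opp i e') else 0))"
    by (rule sum_mono)
  also have "\<dots> = sum m (edges (X' i)) + (\<Sum>e'\<in>C. m (opp i e'))"
    using fin by (simp add: sum.distrib sum.If_cases C_def Collect_conj_eq inf.absorb2)
  also have "(\<Sum>e'\<in>C. m (opp i e')) = sum m (opp i ` C)"
    using inj_on_subset[OF inj_on_opp, of C i] unfolding C_def by (subst sum.reindex) auto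
  also have "sum m (edges (X' i)) + sum m (opp i ` C) = sum m (edges (X' i) \<union> opp i ` C)"
    using fin opp_notin_edges unfolding C_def by (intro sum.union_disjoint[symmetric]) auto
  \<comment> \<open>Any further edges of \<open>X (Suc i)\<close> could only add nonnegative terms,
    so an inclusion is enough.\<close>
  also have "\<dots> \<le> sum m (edges (X (Suc i)))"
  proof (rule sum_mono2)
    show "finite (edges (X (Suc i)))" using graph_finite[OF graph] by blast
    show "edges (X' i) \<union> opp i ` C \<subseteq> edges (X (Suc i))"
      using opp_edge(1) same_edge(1) unfolding C_def by blast
    show "0 \<le> m e" if "e \<in> edges (X (Suc i)) - (edges (X' i) \<union> opp i ` C)" for e
      using that F edge_length_pos[OF graph, of e "Suc i"] unfolding m_def by simp
  qed
  finally have "sum_list (map F (map g P)) \<le> sum m (edges (X (Suc i)))"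
    using P(2) by (simp add: comp_def)
  moreover have "directed_path_from_to (X (Suc i)) v0 v1 (map g P)"
    using opp_edge same_edge unfolding g_def
    by (intro directed_path_from_to_map[OF P(1)]) auto
  ultimately show "\<exists>P. directed_path_from_to (X (Suc i)) v0 v1 P \<and>
      sum_list (map F P) \<le>
        (\<Sum>e\<in>edges (X (Suc i)). F e * (measure (\<mu> (Suc i)) e / edge_length (X (Suc i)) e))"
    unfolding m_def by blast
qed

lemma dominated_X': "dominated i (X' i)"
proof -
  have "dominated i (X i)"
    by (induction i) (auto intro: dominated_0 dominated_Suc dominated_subdivision)
  then show ?thesis by (rule dominated_subdivision)
qed

definition circle_edges :: "nat \<Rightarrow> 'a set set" where
  "circle_edges i = {e' \<in> edges (X' i). opp i e' \<noteq> e'}"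

lemma circle_measure:
  obtains \<beta> where "\<beta> > 0" "\<And>i. \<beta> \<le> measure (\<mu> i) (\<Union>(circle_edges i))"
proof -
  obtain \<beta> where \<beta>: "\<beta> > 0" "\<And>i P. directed_path_from_to (X' i) v0 v1 P \<Longrightarrow>
      \<beta> \<le> (\<Sum>e'\<in>{e' \<in> set P. opp i e' \<noteq> e'}. edge_length (X' i) e')"
    using A6 by blast
  have "\<beta> \<le> measure (\<mu> i) (\<Union>(circle_edges i))" for i
  proof -
    interpret prob_space "\<mu> i" by (rule prob_space_\<mu>)
    \<comment> \<open>With this cost, length times density gives the measure: the average is the
      total measure of the circle edges, while (A6) bounds the cost of every path below.\<close>
    define F where "F e' = (if opp i e' \<noteq> e' then edge_length (X' i) e' else 0)" for e'
    have F0: "0 \<le> F e'" if "e' \<in> edges (X' i)" for e'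
      using edge_length_pos[OF graph' that] unfolding F_def by simp
    then obtain P where P: "directed_path_from_to (X' i) v0 v1 P"
      "sum_list (map F P) \<le> (\<Sum>e'\<in>edges (X' i). F e' * (measure (\<mu> i) e' / edge_length (X' i) e'))"
      using dominated_X'[of i, unfolded dominated_def, rule_format, of F] by auto
    have Pe: "set P \<subseteq> edges (X' i)" using P(1) unfolding directed_path_from_to_def directed_path_def by blast
    have fin: "finite (edges (X' i))" "finite (circle_edges i)"
      using graph_finite[OF graph'] unfolding circle_edges_def by auto
    have V: "verts (X' i) \<in> null_sets (\<mu> i)"
      using graph'[of i] points_X'[of i] unfolding directed_metric_graph_def
      by (intro finite_null_sets) auto
    have "\<beta> \<le> (\<Sum>e'\<in>{e' \<in> set P. opp i e' \<noteq> e'}. edge_length (X' i) e')" by (rule \<beta>(2)[OF P(1)])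
    also have "\<dots> = sum F (set P)" unfolding F_def by (simp add: sum.inter_filter)
    also have "\<dots> \<le> sum_list (map F P)" using F0 Pe by (intro sum_set_le_sum_list) auto
    also note P(2)
    also have "(\<Sum>e'\<in>edges (X' i). F e' * (measure (\<mu> i) e' / edge_length (X' i) e')) =
        (\<Sum>e'\<in>edges (X' i). if opp i e' \<noteq> e' then measure (\<mu> i) e' else 0)"
      using edge_length_pos[OF graph'] unfolding F_def by (intro sum.cong) fastforce+
    also have "\<dots> = (\<Sum>e'\<in>circle_edges i. measure (\<mu> i) e')"
      unfolding circle_edges_def using fin by (simp add: sum.inter_filter)
    \<comment> \<open>Distinct edges can share only vertices, which form a null set; without them
      the pieces are disjoint.\<close>
    also have "\<dots> = (\<Sum>e'\<in>circle_edges i. measure (\<mu> i) (e' - verts (X' i)))"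
      using edge'_in_sets V unfolding circle_edges_def
      by (intro sum.cong refl measure_Diff_null_set[symmetric]) auto
    also have "\<dots> = measure (\<mu> i) (\<Union>e'\<in>circle_edges i. e' - verts (X' i))"
    proof (rule finite_measure_finite_Union[symmetric])
      show "(\<lambda>e'. e' - verts (X' i)) ` circle_edges i \<subseteq> sets (\<mu> i)"
        using edge'_in_sets V unfolding circle_edges_def by auto
      show "disjoint_family_on (\<lambda>e'. e' - verts (X' i)) (circle_edges i)"
        using graph_edges_Int[OF graph'] unfolding disjoint_family_on_def circle_edges_def by blast
    qed (rule fin)
    also have "\<dots> \<le> measure (\<mu> i) (\<Union>(circle_edges i))"
      using edge'_in_sets fin unfolding circle_edges_def
      by (intro finite_measure_mono sets.finite_Union) auto
    finally show ?thesis .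
  qed
  then show thesis using that \<beta>(1) by blast
qed

end

section \<open>The limit space\<close>

text \<open>Both sides are parametrized in proportion to the distance from the common source, so
  that a point and its opposite get the same parameter and (A5) separates the curves at equal
  times.\<close>

lemma (in thick_inverse_system) circle_curves:
  obtains \<kappa> where "\<kappa> > 0" "\<And>i e'. e' \<in> edges (X' i) \<Longrightarrow> opp i e' \<noteq> e' \<Longrightarrow>
    \<exists>a b. (\<forall>t\<in>{0..1}. a t \<in> e' \<and> b t \<in> opp i e') \<and>
      (\<forall>s\<in>{0..1}. \<forall>t\<in>{0..1}. dist (a s) (a t) = \<bar>s - t\<bar> * edge_length (X' i) e' \<and>
         dist (b s) (b t) = \<bar>s - t\<bar> * edge_length (X' i) e') \<and>
      a 0 = b 0 \<and> a 1 = b 1 \<and> (\<exists>s\<in>{0..1}. \<kappa> * edge_length (X' i) e' \<le> dist (a s) (b s))"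
proof -
  obtain \<alpha> where \<alpha>: "\<alpha> > 0" "\<And>i e'. e' \<in> edges (X' i) \<Longrightarrow> opp i e' \<noteq> e' \<Longrightarrow>
      \<alpha> * edge_length (X' i) e' \<le> (SUP p\<in>e'. dist p (opp_point \<pi> opp i e' p))"
    using A5 by blast
  have "\<exists>a b. (\<forall>t\<in>{0..1}. a t \<in> e' \<and> b t \<in> opp i e') \<and>
      (\<forall>s\<in>{0..1}. \<forall>t\<in>{0..1}. dist (a s) (a t) = \<bar>s - t\<bar> * edge_length (X' i) e' \<and>
         dist (b s) (b t) = \<bar>s - t\<bar> * edge_length (X' i) e') \<and>
      a 0 = b 0 \<and> a 1 = b 1 \<and> (\<exists>s\<in>{0..1}. \<alpha> / 2 * edge_length (X' i) e' \<le> dist (a s) (b s))"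
    if e': "e' \<in> edges (X' i)" "opp i e' \<noteq> e'" for i e'
  proof -
    let ?u = "src (X' i) e'" and ?v = "snk (X' i) e'"
    define r where "r = edge_length (X' i) e'"
    have r: "r > 0" "r = dist ?u ?v"
      using edge_length_pos[OF graph' e'(1)] unfolding r_def edge_length_def by auto
    note seg = segment'[OF e'(1)]
    have tr: "0 \<le> t * r" "t * r \<le> dist ?u ?v" if "t \<in> {0..1}" for t
      using that r mult_right_mono[of t 1 r] by auto
    have "\<exists>p\<in>e'. dist ?u p = t * r" "\<exists>p\<in>opp i e'. dist ?u p = t * r" if "t \<in> {0..1}" for t
      using segment_point[OF seg(1) tr[OF that]] segment_point[OF seg(2) tr[OF that]] by metis+
    then obtain a b where a: "\<And>t. t \<in> {0..1} \<Longrightarrow> a t \<in> e' \<and> dist ?u (a t) = t * r"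
      and b: "\<And>t. t \<in> {0..1} \<Longrightarrow> b t \<in> opp i e' \<and> dist ?u (b t) = t * r"
      by metis
    have "dist (a s) (a t) = \<bar>s - t\<bar> * r \<and> dist (b s) (b t) = \<bar>s - t\<bar> * r"
      if "s \<in> {0..1}" "t \<in> {0..1}" for s t
      using segment_dist[OF seg(1), of "a s" "a t"] segment_dist[OF seg(2), of "b s" "b t"]
        a[OF that(1)] a[OF that(2)] b[OF that(1)] b[OF that(2)] r(1)
      by (simp add: abs_mult flip: left_diff_distrib)
    moreover have "a 0 = b 0" using a[of 0] b[of 0] by simp
    moreover have "a 1 = ?v" "b 1 = ?v"
      using segment_eqI[OF seg(1), of "a 1" ?v] segment_eqI[OF seg(2), of "b 1" ?v] a[of 1] b[of 1]
        segment_ends[OF seg(1)] segment_ends[OF seg(2)] r(2) by auto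
    moreover have "\<exists>s\<in>{0..1}. \<alpha> / 2 * r \<le> dist (a s) (b s)"
    proof -
      \<comment> \<open>Halving \<alpha> gives a strict bound below the supremum in (A5), so a point
        exceeding it exists without an appeal to attainment.\<close>
      have "\<exists>p\<in>e'. \<alpha> / 2 * r < dist p (opp_point \<pi> opp i e' p)"
      proof (rule ccontr)
        assume "\<not> ?thesis"
        then have "(SUP p\<in>e'. dist p (opp_point \<pi> opp i e' p)) \<le> \<alpha> / 2 * r"
          using segment_ends[OF seg(1)] by (intro cSUP_least) (auto simp: not_less)
        moreover have "\<alpha> / 2 * r < \<alpha> * r" using \<alpha>(1) r(1) by simp
        ultimately show False using \<alpha>(2)[OF e'] unfolding r_def by simp
      qed
      then obtain p where p: "p \<in> e'" "\<alpha> / 2 * r < dist p (opp_point \<pi> opp i e' p)" by blast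
      define s where "s = dist ?u p / r"
      have s: "s \<in> {0..1}" "s * r = dist ?u p"
        using r segment_dist_le[OF seg(1) p(1)] unfolding s_def by auto
      have "a s = p" using segment_eqI[OF seg(1) _ p(1)] a[OF s(1)] s(2) by simp
      moreover have "b s = opp_point \<pi> opp i e' p"
        using segment_eqI[OF seg(2) _ opp_point(1)[OF e'(1) p(1)]] b[OF s(1)] s(2)
          opp_point(2)[OF e'(1) p(1)] by simp
      ultimately show ?thesis using p(2) s(1) by (intro bexI[of _ s]) auto
    qed
    ultimately show ?thesis using a b unfolding r_def by (intro exI[of _ a] exI[of _ b]) auto
  qed
  then show thesis using that[of "\<alpha> / 2"] \<alpha>(1) by simp
qed

text \<open>The bound 1/2 is the form in which the smallness of \<open>delta_E\<close> enters: it
  makes the shortest edge lengths decay geometrically.\<close>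

locale thick_limit = measured_thick_system X X' \<pi> opp v0 v1 \<mu>
  for X X' :: "nat \<Rightarrow> 'a::metric_space mgraph" and \<pi> opp v0 v1 \<mu> +
  fixes \<pi>_inf :: "nat \<Rightarrow> 'a \<Rightarrow> 'a" and \<mu>_inf :: "'a measure"
  assumes delta_E_half: "\<And>i. delta_E (X' i) (X i) \<le> 1 / 2"
    and limit_proj: "limit_projections X \<pi> \<pi>_inf"
    and limit_meas: "limit_measure X \<pi>_inf \<mu> \<mu>_inf"
begin

lemma edges_nonempty: "edges (X i) \<noteq> {}" "edges (X' i) \<noteq> {}"
proof -
  have "v0 \<in> points (X 0)"
    using graph[of 0] A1(1) unfolding directed_metric_graph_def by blast
  then have "v0 \<in> points (X i)" using points_mono[of 0 i] by blast
  then show "edges (X i) \<noteq> {}" "edges (X' i) \<noteq> {}"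
    using points_X'[of i] unfolding points_def by auto
qed

lemma Delta_E_le: "e \<in> edges (X i) \<Longrightarrow> Delta_E (X i) \<le> edge_length (X i) e"
  unfolding Delta_E_def using graph_finite[OF graph] by (intro Min_le) auto

lemma Delta_E_pos: "0 < Delta_E (X i)"
  unfolding Delta_E_def using graph_finite[OF graph, of i] edges_nonempty(1) edge_length_pos[OF graph]
  by (subst Min_gr_iff) auto

lemma subedge_short:
  assumes "e' \<in> edges (X' i)"
  shows "edge_length (X' i) e' \<le> Delta_E (X i) / 2"
proof -
  have "edge_length (X' i) e' \<le> Max (edge_length (X' i) ` edges (X' i))"
    using assms graph_finite[OF graph'] by (intro Max_ge) auto
  also have "\<dots> \<le> Delta_E (X i) / 2"
    using delta_E_half[of i] Delta_E_pos[of i] unfolding delta_E_def by (simp add: field_simps)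
  finally show ?thesis .
qed

text \<open>Edges of the subdivision are themselves edges of the next graph, and they have at most
  half the minimal length of the present one.\<close>

lemma Delta_E_Suc: "Delta_E (X (Suc i)) \<le> Delta_E (X i) / 2"
proof -
  obtain e' where e': "e' \<in> edges (X' i)" using edges_nonempty(2) by blast
  show ?thesis
    using Delta_E_le[OF same_edge(1)[OF e']] edge_length_lift(1)[OF e'] subedge_short[OF e'] by simp
qed

lemma proj_self: "proj \<pi> i i = id"
  by (cases i) simp_all

lemma proj_Suc_right: "i \<le> k \<Longrightarrow> proj \<pi> i (Suc k) p = proj \<pi> i k (\<pi> k p)"
  by simp

lemma proj_Suc_left: "Suc i \<le> k \<Longrightarrow> proj \<pi> i k p = \<pi> i (proj \<pi> (Suc i) k p)"
proof (induction k arbitrary: p)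
  case (Suc k)
  show ?case
  proof (cases "Suc i \<le> k")
    case True
    then show ?thesis using Suc.IH by simp
  next
    case False
    then have "k = i" using Suc.prems by simp
    then show ?thesis by (simp add: proj_self del: proj.simps) (simp add: proj_self)
  qed
qed simp

text \<open>One projection from level \<open>Suc k\<close> moves a point by at most
  \<open>Delta_E (X k)\<close>, hence by at most twice the drop from \<open>Delta_E (X k)\<close> to
  \<open>Delta_E (X (Suc k))\<close>. The difference form makes the induction telescope.\<close>

lemma proj_near:
  assumes "i \<le> k" "p \<in> points (X k)"
  shows "proj \<pi> i k p \<in> points (X i) \<and> dist p (proj \<pi> i k p) \<le> 2 * Delta_E (X i) - 2 * Delta_E (X k)"
  using assms
proof (induction k arbitrary: p rule: dec_induct)
  case base
  then show ?case by (simp add: proj_self)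
next
  case (step k)
  have q: "\<pi> k p \<in> points (X k)" using maps_to step.prems by blast
  obtain e' where e': "e' \<in> edges (X' k)" "dist p (\<pi> k p) \<le> 2 * edge_length (X' k) e'"
    using proj_displacement[OF step.prems] by blast
  have "dist p (proj \<pi> i (Suc k) p) \<le> dist p (\<pi> k p) + dist (\<pi> k p) (proj \<pi> i k (\<pi> k p))"
    unfolding proj_Suc_right[OF step.hyps(1)] by (rule dist_triangle)
  then show ?case
    using step.IH[OF q] e'(2) subedge_short[OF e'(1)] Delta_E_Suc[of k]
    unfolding proj_Suc_right[OF step.hyps(1)] by auto
qed

lemma proj_inf_eq: "i \<le> j \<Longrightarrow> x \<in> points (X j) \<Longrightarrow> \<pi>_inf i x = proj \<pi> i j x"
  using limit_proj[unfolded limit_projections_def, rule_format, of i] by simp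

lemma proj_inf_continuous: "continuous_on (limit_space X) (\<pi>_inf i)"
  using limit_proj[unfolded limit_projections_def, rule_format, of i] by simp

lemma points_limit: "points (X i) \<subseteq> limit_space X"
  unfolding limit_space_def by (rule order_trans[OF _ closure_subset]) blast

lemma union_points_level:
  assumes "x \<in> (\<Union>i. points (X i))"
  obtains k where "i \<le> k" "x \<in> points (X k)"
proof -
  obtain j where "x \<in> points (X j)" using assms by blast
  then have "x \<in> points (X (max i j))" using points_mono[of j "max i j"] by auto
  then show thesis using that[of "max i j"] by simp
qed

lemma proj_inf_in_points:
  assumes "x \<in> limit_space X"
  shows "\<pi>_inf i x \<in> points (X i)"
proof -
  have "\<pi>_inf i ` closure (\<Union>i. points (X i)) \<subseteq> points (X i)"
  proof (rule image_closure_subset)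
    show "continuous_on (closure (\<Union>i. points (X i))) (\<pi>_inf i)"
      using proj_inf_continuous unfolding limit_space_def .
    show "closed (points (X i))" by (rule compact_imp_closed[OF graph_compact[OF graph]])
    show "\<pi>_inf i ` (\<Union>i. points (X i)) \<subseteq> points (X i)"
    proof (rule image_subsetI)
      fix p assume "p \<in> (\<Union>i. points (X i))"
      then obtain k where "i \<le> k" "p \<in> points (X k)" by (rule union_points_level)
      then show "\<pi>_inf i p \<in> points (X i)" using proj_near proj_inf_eq by simp
    qed
  qed
  then show ?thesis using assms unfolding limit_space_def by blast
qed

lemma proj_inf_near:
  assumes "x \<in> limit_space X"
  shows "dist x (\<pi>_inf i x) \<le> 2 * Delta_E (X i)"
proof (rule continuous_le_on_closure[where f = "\<lambda>x. dist x (\<pi>_inf i x)"])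
  show "continuous_on (closure (\<Union>i. points (X i))) (\<lambda>x. dist x (\<pi>_inf i x))"
    using proj_inf_continuous[of i] unfolding limit_space_def by (intro continuous_intros)
  show "x \<in> closure (\<Union>i. points (X i))" using assms unfolding limit_space_def .
  fix p assume "p \<in> (\<Union>i. points (X i))"
  then obtain k where "i \<le> k" "p \<in> points (X k)" by (rule union_points_level)
  then show "dist p (\<pi>_inf i p) \<le> 2 * Delta_E (X i)"
    using proj_near[of i k p] proj_inf_eq Delta_E_pos[of k] by simp
qed

text \<open>On the dense union of the graphs this is the composition rule for \<open>proj\<close>;
  both sides are continuous, so it passes to the closure.\<close>

lemma proj_inf_Suc:
  assumes "x \<in> limit_space X"
  shows "\<pi> i (\<pi>_inf (Suc i) x) = \<pi>_inf i x"
proof -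
  have eq: "\<pi>_inf i y = \<pi> i y" if "y \<in> points (X (Suc i))" for y
    using proj_inf_eq[of i "Suc i" y] that by (simp add: proj_self)
  have "dist (\<pi>_inf i (\<pi>_inf (Suc i) x)) (\<pi>_inf i x) = 0"
  proof (rule continuous_constant_on_closure[where f = "\<lambda>x. dist (\<pi>_inf i (\<pi>_inf (Suc i) x)) (\<pi>_inf i x)"])
    have "continuous_on (limit_space X) (\<lambda>x. dist (\<pi>_inf i (\<pi>_inf (Suc i) x)) (\<pi>_inf i x))"
      using proj_inf_in_points[of _ "Suc i"] points_limit[of "Suc i"]
      by (intro continuous_on_dist proj_inf_continuous
          continuous_on_compose2[OF proj_inf_continuous proj_inf_continuous]) blast
    then show "continuous_on (closure (\<Union>i. points (X i)))
        (\<lambda>x. dist (\<pi>_inf i (\<pi>_inf (Suc i) x)) (\<pi>_inf i x))"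
      unfolding limit_space_def .
    show "x \<in> closure (\<Union>i. points (X i))" using assms unfolding limit_space_def .
    fix p assume "p \<in> (\<Union>i. points (X i))"
    then obtain k where k: "Suc i \<le> k" "p \<in> points (X k)" by (rule union_points_level)
    have "\<pi>_inf i (\<pi>_inf (Suc i) p) = \<pi> i (proj \<pi> (Suc i) k p)"
      using eq proj_inf_eq[OF k] proj_near[OF k] by simp
    also have "\<dots> = \<pi>_inf i p" using proj_Suc_left[OF k(1)] proj_inf_eq[of i k p] k by simp
    finally show "dist (\<pi>_inf i (\<pi>_inf (Suc i) p)) (\<pi>_inf i p) = 0" by simp
  qed
  then show ?thesis using eq[OF proj_inf_in_points[OF assms]] by simp
qed

section \<open>The limit measure\<close>

lemma prob_space_\<mu>_inf: "prob_space \<mu>_inf"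
  and sets_\<mu>_inf: "sets \<mu>_inf = sets (restrict_space borel (limit_space X))"
  and distr_\<mu>_inf: "distr \<mu>_inf (restrict_space borel (points (X i))) (\<pi>_inf i) = \<mu> i"
  using limit_meas[unfolded limit_measure_def] by simp_all

lemma space_\<mu>_inf: "space \<mu>_inf = limit_space X"
  using sets_eq_imp_space_eq[OF sets_\<mu>_inf] by (simp add: space_restrict_space)

lemma proj_inf_measurable: "\<pi>_inf i \<in> measurable \<mu>_inf (restrict_space borel (points (X i)))"
proof (rule measurable_restrict_space2)
  show "\<pi>_inf i \<in> space \<mu>_inf \<rightarrow> points (X i)" using proj_inf_in_points space_\<mu>_inf by simp
  show "\<pi>_inf i \<in> borel_measurable \<mu>_inf"
    unfolding measurable_cong_sets[OF sets_\<mu>_inf refl]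
    by (rule borel_measurable_continuous_on_restrict[OF proj_inf_continuous])
qed

lemma preimage_measure:
  assumes "A \<in> sets (\<mu> i)"
  shows "\<pi>_inf i -` A \<inter> limit_space X \<in> sets \<mu>_inf"
    "emeasure \<mu>_inf (\<pi>_inf i -` A \<inter> limit_space X) = emeasure (\<mu> i) A"
proof -
  have A: "A \<in> sets (restrict_space borel (points (X i)))" using assms sets_\<mu> by blast
  show "\<pi>_inf i -` A \<inter> limit_space X \<in> sets \<mu>_inf"
    using measurable_sets[OF proj_inf_measurable A] space_\<mu>_inf by simp
  show "emeasure \<mu>_inf (\<pi>_inf i -` A \<inter> limit_space X) = emeasure (\<mu> i) A"
    using emeasure_distr[OF proj_inf_measurable A] distr_\<mu>_inf[of i] space_\<mu>_inf by simp
qed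

text \<open>The limit superior of the circle events. Removing the fibres over vertices makes the
  edge of each level at a point unique, hence its scale meaningful.\<close>

definition circle_points :: "'a set" where
  "circle_points =
     (\<Inter>n. \<Union>i\<in>{n..}. \<pi>_inf i -` \<Union>(circle_edges i) \<inter> limit_space X) -
     (\<Union>i. \<pi>_inf i -` verts (X i) \<inter> limit_space X)"

text \<open>The tail unions decrease, and the one from \<open>n\<close> on contains the event of
  level \<open>n\<close>, so each has measure at least \<beta>. Continuity from above passes this to
  the intersection, and the fibres over vertices are null.\<close>

lemma circle_points_positive: "circle_points \<in> sets \<mu>_inf" "emeasure \<mu>_inf circle_points > 0"
proof -
  interpret prob_space \<mu>_inf by (rule prob_space_\<mu>_inf)
  define C where "C i = \<pi>_inf i -` \<Union>(circle_edges i) \<inter> limit_space X" for i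
  define T where "T n = (\<Union>i\<in>{n..}. C i)" for n
  define N where "N = (\<Union>i. \<pi>_inf i -` verts (X i) \<inter> limit_space X)"
  obtain \<beta> where \<beta>: "\<beta> > 0" "\<And>i. \<beta> \<le> measure (\<mu> i) (\<Union>(circle_edges i))"
    using circle_measure by blast
  have circ: "\<Union>(circle_edges i) \<in> sets (\<mu> i)" for i
    using edge'_in_sets graph_finite[OF graph', of i] unfolding circle_edges_def
    by (intro sets.finite_Union) auto
  have C: "C i \<in> sets \<mu>_inf" "\<beta> \<le> measure \<mu>_inf (C i)" for i
    using preimage_measure[OF circ[of i]] \<beta>(2)[of i] unfolding C_def by (simp_all add: measure_def)
  have T: "T n \<in> sets \<mu>_inf" for n using C(1) unfolding T_def by auto
  have "\<beta> \<le> measure \<mu>_inf (T n)" for n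
    using C(2)[of n] finite_measure_mono[OF _ T[of n], of "C n"] unfolding T_def by fastforce
  moreover have "(\<lambda>n. measure \<mu>_inf (T n)) \<longlonglongrightarrow> measure \<mu>_inf (\<Inter>n. T n)"
  proof (rule finite_Lim_measure_decseq)
    show "range T \<subseteq> sets \<mu>_inf" using T by blast
    show "decseq T" unfolding decseq_def T_def by (intro allI impI UN_mono) auto
  qed
  ultimately have lim: "\<beta> \<le> measure \<mu>_inf (\<Inter>n. T n)" by (intro LIMSEQ_le_const) auto
  have "N \<in> null_sets \<mu>_inf" unfolding N_def
  proof (rule null_sets_UN)
    fix i
    have "verts (X i) \<in> null_sets (\<mu> i)"
      using graph[of i] unfolding directed_metric_graph_def by (intro finite_null_sets) auto
    then show "\<pi>_inf i -` verts (X i) \<inter> limit_space X \<in> null_sets \<mu>_inf"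
      using preimage_measure[of "verts (X i)" i] by (auto simp: null_sets_def)
  qed
  moreover have inter: "(\<Inter>n. T n) \<in> sets \<mu>_inf" using T by auto
  moreover have eq: "circle_points = (\<Inter>n. T n) - N"
    unfolding circle_points_def T_def C_def N_def ..
  ultimately show "circle_points \<in> sets \<mu>_inf" by auto
  have "measure \<mu>_inf circle_points = measure \<mu>_inf (\<Inter>n. T n)"
    unfolding eq using inter \<open>N \<in> null_sets \<mu>_inf\<close> by (rule measure_Diff_null_set)
  then show "emeasure \<mu>_inf circle_points > 0"
    using lim \<beta>(1) by (simp add: emeasure_eq_measure)
qed

lemma circle_points_nonvertex: "x \<in> circle_points \<Longrightarrow> nonvertex X \<pi>_inf x"
  unfolding circle_points_def nonvertex_def by auto

lemma circle_points_infinite: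
  assumes "x \<in> circle_points"
  shows "infinite {i. \<pi>_inf i x \<in> \<Union>(circle_edges i)}"
  unfolding infinite_nat_iff_unbounded_le using assms unfolding circle_points_def by fastforce

section \<open>Scales at a nonvertex point\<close>

lemma scale_at_eq:
  assumes x: "nonvertex X \<pi>_inf x" and e: "e \<in> edges (X i)" "\<pi>_inf i x \<in> e"
  shows "scale_at X \<pi>_inf x i = edge_length (X i) e"
proof -
  have "edge_at X \<pi>_inf x i = e"
    unfolding edge_at_def
  proof (rule the_equality)
    \<comment> \<open>Two edges through the projection would meet there, and distinct edges meet
      only in vertices.\<close>
    show "f = e" if "f \<in> edges (X i) \<and> \<pi>_inf i x \<in> f" for f
      using graph_edges_Int[OF graph, of f i e] that e x unfolding nonvertex_def by blast
  qed (use e in blast)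
  then show ?thesis unfolding scale_at_def by simp
qed

lemma scale_at_ge:
  assumes x: "nonvertex X \<pi>_inf x"
  shows "Delta_E (X i) \<le> scale_at X \<pi>_inf x i"
proof -
  have "\<pi>_inf i x \<in> points (X i)" using x proj_inf_in_points unfolding nonvertex_def by blast
  then obtain e where "e \<in> edges (X i)" "\<pi>_inf i x \<in> e" unfolding points_def by blast
  then show ?thesis using scale_at_eq[OF x] Delta_E_le by simp
qed

lemma circle_near:
  assumes x: "nonvertex X \<pi>_inf x" and e': "e' \<in> edges (X' i)" "\<pi>_inf i x \<in> e'"
  shows "scale_at X \<pi>_inf x (Suc i) = edge_length (X' i) e'"
    "q \<in> e' \<union> opp i e' \<Longrightarrow> q \<in> limit_space X \<and> dist q x \<le> 4 * edge_length (X' i) e'"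
proof -
  have lim: "x \<in> limit_space X" using x unfolding nonvertex_def by blast
  define y where "y = \<pi>_inf (Suc i) x"
  have "y \<in> points (X (Suc i))" "\<pi> i y \<in> e'"
    using proj_inf_in_points[OF lim] proj_inf_Suc[OF lim] e'(2) unfolding y_def by auto
  \<comment> \<open>The side containing \<open>y\<close> is unknown, but both sides have the length
    of \<open>e'\<close>, so the scale is the same in either case.\<close>
  then have y: "y \<in> e' \<union> opp i e'" using A2_preimage[OF e'(1)] by blast
  then show sc: "scale_at X \<pi>_inf x (Suc i) = edge_length (X' i) e'"
    using scale_at_eq[OF x same_edge(1)[OF e'(1)]] scale_at_eq[OF x opp_edge(1)[OF e'(1)]]
      edge_length_lift[OF e'(1)] unfolding y_def by auto
  assume q: "q \<in> e' \<union> opp i e'"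
  have src: "dist (src (X' i) e') p \<le> edge_length (X' i) e'" if "p \<in> e' \<union> opp i e'" for p
    using that segment_dist_le[OF segment'(1)[OF e'(1)]] segment_dist_le[OF segment'(2)[OF e'(1)]]
    unfolding edge_length_def by blast
  have "dist q x \<le> dist q (src (X' i) e') + (dist (src (X' i) e') y + dist y x)"
    by (meson add_left_mono dist_triangle order_trans)
  \<comment> \<open>Twice the shortest edge of \<open>X (Suc i)\<close> bounds this distance, and
    the edge through \<open>y\<close> is at least that long.\<close>
  also have "dist y x \<le> 2 * edge_length (X' i) e'"
    using proj_inf_near[OF lim, of "Suc i"] scale_at_ge[OF x, of "Suc i"] sc
    unfolding y_def by (simp add: dist_commute)
  finally have "dist q x \<le> 4 * edge_length (X' i) e'"
    using src[OF q] src[OF y] by (simp add: dist_commute)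
  moreover have "q \<in> limit_space X"
    using q same_edge(1)[OF e'(1)] opp_edge(1)[OF e'(1)] edge_subset_points points_limit by blast
  ultimately show "q \<in> limit_space X \<and> dist q x \<le> 4 * edge_length (X' i) e'" by blast
qed

end

section \<open>Circles in the tangent cone\<close>

lemma (in thick_limit) tangent_cone_not_embeddable:
  assumes x: "x \<in> circle_points"
  obtains U :: "nat filter" where "nonprincipal_ultrafilter U"
    "\<And>f. \<not> embedding_map
       (tangent_cone_topology (limit_space X) x (scale_at X \<pi>_inf x) U) euclideanreal f"
proof -
  let ?r = "scale_at X \<pi>_inf x"
  define d where "d = (\<lambda>i (p :: 'a) q. dist p q / ?r i)"
  \<comment> \<open>Shifted by one: a circle over an edge of \<open>X' i\<close> has unit sides at
    the scale of level \<open>Suc i\<close>.\<close>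
  define I where "I = Suc ` {i. \<pi>_inf i x \<in> \<Union>(circle_edges i)}"
  have nv: "nonvertex X \<pi>_inf x" by (rule circle_points_nonvertex[OF x])
  then have lim: "x \<in> limit_space X" unfolding nonvertex_def by blast
  have r: "?r i > 0" for i using Delta_E_pos[of i] scale_at_ge[OF nv, of i] by linarith
  have "infinite I"
    using circle_points_infinite[OF x] unfolding I_def by (simp add: finite_image_iff)
  then obtain U where U: "nonprincipal_ultrafilter U" "eventually (\<lambda>n. n \<in> I) U"
    by (rule nonprincipal_ultrafilter_containing)
  obtain \<kappa> where \<kappa>: "\<kappa> > 0" "\<And>i e'. e' \<in> edges (X' i) \<Longrightarrow> opp i e' \<noteq> e' \<Longrightarrow>
    \<exists>a b. (\<forall>t\<in>{0..1}. a t \<in> e' \<and> b t \<in> opp i e') \<and>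
      (\<forall>s\<in>{0..1}. \<forall>t\<in>{0..1}. dist (a s) (a t) = \<bar>s - t\<bar> * edge_length (X' i) e' \<and>
         dist (b s) (b t) = \<bar>s - t\<bar> * edge_length (X' i) e') \<and>
      a 0 = b 0 \<and> a 1 = b 1 \<and> (\<exists>s\<in>{0..1}. \<kappa> * edge_length (X' i) e' \<le> dist (a s) (b s))"
    using circle_curves by blast
  \<comment> \<open>All requirements on both curves and on the separating parameter are bundled, so
    that one choice over \<open>n \<in> I\<close> yields them together.\<close>
  define pair where "pair n a b s \<longleftrightarrow>
      (\<forall>t\<in>{0..1}. a t \<in> limit_space X \<and> d n (a t) x \<le> 4 \<and> b t \<in> limit_space X \<and> d n (b t) x \<le> 4) \<and>
      (\<forall>s\<in>{0..1}. \<forall>t\<in>{0..1}. d n (a s) (a t) = \<bar>s - t\<bar> \<and> d n (b s) (b t) = \<bar>s - t\<bar>) \<and>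
      a 0 = b 0 \<and> a 1 = b 1 \<and> s \<in> {0..1} \<and> \<kappa> \<le> d n (a s) (b s)"
    for n and a b :: "real \<Rightarrow> 'a" and s
  have "\<exists>a b s. pair n a b s" if "n \<in> I" for n
  proof -
    obtain i e' where i: "n = Suc i" "e' \<in> edges (X' i)" "opp i e' \<noteq> e'" "\<pi>_inf i x \<in> e'"
      using \<open>n \<in> I\<close> unfolding I_def circle_edges_def by blast
    note near = circle_near[OF nv i(2,4)]
    have len: "edge_length (X' i) e' = ?r n" using near(1) i(1) by simp
    obtain a b s where ab: "\<And>t. t \<in> {0..1} \<Longrightarrow> a t \<in> e' \<and> b t \<in> opp i e'"
      "\<And>s t. s \<in> {0..1} \<Longrightarrow> t \<in> {0..1} \<Longrightarrow> dist (a s) (a t) = \<bar>s - t\<bar> * ?r n \<and>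
         dist (b s) (b t) = \<bar>s - t\<bar> * ?r n"
      "a 0 = b 0" "a 1 = b 1" and s: "s \<in> {0..1}" "\<kappa> * ?r n \<le> dist (a s) (b s)"
      using \<kappa>(2)[OF i(2,3)] unfolding len by blast
    have "a t \<in> limit_space X \<and> d n (a t) x \<le> 4 \<and> b t \<in> limit_space X \<and> d n (b t) x \<le> 4"
      if "t \<in> {0..1}" for t
      using near(2)[of "a t"] near(2)[of "b t"] ab(1)[OF that] r[of n]
      unfolding len d_def by (simp add: divide_le_eq)
    moreover have "d n (a s) (a t) = \<bar>s - t\<bar> \<and> d n (b s) (b t) = \<bar>s - t\<bar>"
      if "s \<in> {0..1}" "t \<in> {0..1}" for s t
      using ab(2)[OF that] r[of n] unfolding d_def by simp
    moreover have "\<kappa> \<le> d n (a s) (b s)" using s(2) r[of n] unfolding d_def by (simp add: le_divide_eq)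
    ultimately show ?thesis
      using ab(3,4) s(1) unfolding pair_def by (intro exI[of _ a] exI[of _ b] exI[of _ s]) simp
  qed
  then obtain a b \<sigma> where curves: "\<And>n. n \<in> I \<Longrightarrow> pair n (a n) (b n) (\<sigma> n)"
    by metis
  have M: "Metric_space (limit_space X) (d n)" for n
  proof
    show "d n p s \<le> d n p q + d n q s" for p q s
      using r[of n] dist_triangle[of p s q]
      unfolding d_def by (simp add: divide_right_mono flip: add_divide_distrib)
  qed (use r[of n] in \<open>auto simp: d_def dist_commute\<close>)
  have ultra: "ultrafilter U" using U(1) unfolding nonprincipal_ultrafilter_def by blast
  have "\<not> embedding_map (Metric_space.mtopology (ultralimit U (\<lambda>n. limit_space X) d (\<lambda>n. x))
      (ultra_dist U (\<lambda>n. limit_space X) d (\<lambda>n. x))) euclideanreal f" for f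
    by (rule ultralimit_not_embeddable[where a = a and b = b and \<sigma> = \<sigma> and B = 4 and I = I and \<kappa> = \<kappa>])
      (use ultra M lim U(2) \<kappa>(1) curves in \<open>simp_all add: pair_def\<close>)
  then show thesis
    using that[OF U(1)] unfolding tangent_cone_topology_def d_def Let_def by blast
qed

theorem theorem4p7:
  fixes X X' :: "nat \<Rightarrow> 'a::complete_space mgraph"
    and \<pi> \<pi>_inf :: "nat \<Rightarrow> 'a \<Rightarrow> 'a"
    and opp :: "nat \<Rightarrow> 'a set \<Rightarrow> 'a set"
    and v0 v1 :: 'a
    and \<mu> :: "nat \<Rightarrow> 'a measure" and \<mu>_inf :: "'a measure"
    and \<delta>' :: "nat \<Rightarrow> real" and L :: real
  assumes "\<exists>a b p q (\<Gamma> :: (real \<Rightarrow> 'a) set). thick_family a b p q \<Gamma>"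
    and "\<And>i. \<delta>' i > 0" and "decseq \<delta>'" and "\<delta>' \<longlonglongrightarrow> 0" and "\<delta>' 0 < 1 / 2"
    and "convergent_prod (\<lambda>i. 1 / (1 - 2 * \<delta>' i))"
    and "prodinf (\<lambda>i. 1 / (1 - 2 * \<delta>' i)) \<le> L"
    and "thick_inverse_system X X' \<pi> opp v0 v1"
    and "system_measures X X' opp \<mu>"
    and "\<And>i. delta_E (X' i) (X i) \<le> \<delta>' i"
    and "\<And>i. delta_d (X' i) (X i) \<le> ennreal (\<delta>' i)"
    and "limit_projections X \<pi> \<pi>_inf"
    and "limit_measure X \<pi>_inf \<mu> \<mu>_inf"
  shows "\<exists>S \<in> sets (restrict_space borel (limit_space X)).
           (\<forall>x\<in>S. nonvertex X \<pi>_inf x) \<and> emeasure \<mu>_inf S > 0 \<and>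
           (\<forall>x\<in>S. \<exists>U :: nat filter. nonprincipal_ultrafilter U \<and>
              \<not> (\<exists>f. embedding_map
                     (tangent_cone_topology (limit_space X) x (scale_at X \<pi>_inf x) U)
                     euclideanreal f))"
proof -
  \<comment> \<open>As \<delta>' decreases, its initial value below 1/2 bounds all levels at
    once.\<close>
  have "delta_E (X' i) (X i) \<le> 1 / 2" for i
    using assms(10)[of i] decseqD[OF assms(3), of 0 i] assms(5) by simp
  then interpret thick_limit X X' \<pi> opp v0 v1 \<mu> \<pi>_inf \<mu>_inf
    using assms(8,9,12,13)
    by (intro thick_limit.intro measured_thick_system.intro measured_thick_system_axioms.intro
        thick_limit_axioms.intro)
  show ?thesis
  proof (intro bexI[of _ circle_points] conjI ballI)
    show "nonvertex X \<pi>_inf x" if "x \<in> circle_points" for x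
      by (rule circle_points_nonvertex[OF that])
    show "emeasure \<mu>_inf circle_points > 0" by (rule circle_points_positive(2))
    show "circle_points \<in> sets (restrict_space borel (limit_space X))"
      using circle_points_positive(1) sets_\<mu>_inf by blast
    show "\<exists>U :: nat filter. nonprincipal_ultrafilter U \<and>
        \<not> (\<exists>f. embedding_map
              (tangent_cone_topology (limit_space X) x (scale_at X \<pi>_inf x) U) euclideanreal f)"
      if "x \<in> circle_points" for x
      by (rule tangent_cone_not_embeddable[OF that]) blast
  qed
qed

end
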